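(* Let $p\in[2,m-2)$, $\varepsilon>0$, $S\subset\mathbf{R}^n$ a submanifold, $\phi\in C^\infty(\mathbf{R}^m_+)$, $f>0$ smooth on $\mathbf{R}^m_+$ with $\partial_rf\ge0$ ($r=|x|$), and suppose there is a constant $c>0$ with \[ \Big(c+2p-m+\sum_i\frac{\partial\phi}{\partial x_i}x_i\Big)f(x)\le\Big(\frac m2-p\Big)\sum_i\frac{\partial f}{\partial x_i}x_i\quad\text{for all }x. \] Let $u:(\mathbf{R}^m_+,g=fg_0,e^{-\phi}dv_g)\to\mathbf{R}^n$ be a $C^1$ $\phi$-$\Phi_{S,p,\varepsilon}$ harmonic map with free boundary on $S$: $u(\partial\mathbf{R}^m_+)\subset S$ and $\frac{\partial u}{\partial\nu}\perp T_uS$ on $\partial\mathbf{R}^m_+$. If $E_{\Phi_{S,p,\varepsilon},\phi}(u)<\infty$, then $u$ is constant.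
   Context: $\mathbf{R}^m_+=\{x_m\ge0\}$, $g_0$ Euclidean metric, $\mathbf{R}^n$ with the Euclidean metric $h$. For $u$, $u^*h(X,Y)=h(du(X),du(Y))$ and $\|u^*h\|$ its norm w.r.t. $g$. The energy is \[ E_{\Phi_{S,p,\varepsilon},\phi}(u)=\int\Big\{\frac1{2p}\Big[\frac{m-2p}{p^2}|du|^{2p}+m^{\frac p2-1}\|u^*h\|^p\Big]+\frac1{4\varepsilon^n}(1-|u|^2)^2\Big\}e^{-\phi}dv_g, \] and a $\phi$-$\Phi_{S,p,\varepsilon}$ harmonic map is a critical point of it, i.e. $\operatorname{div}(\sigma_{p,u})+\varepsilon^{-n}(1-|u|^2)u-\sigma_{p,u}(\nabla\phi)=0$ where $\sigma_{p,u}(X)=\sum_j m^{\frac p2-1}\|u^*h\|^{p-2}h(du(e_j),du(X))du(e_j)+\frac{m-2p}{p^2}|du|^{2p-2}du(X)$. Free boundary on $S$ means critical among maps with $u(\partial\mathbf{R}^m_+)\subset S$, giving the stated boundary conditions. *)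

theory Defs
  imports "HOL-Analysis.Analysis"
begin

coinductive smooth_on :: "(real^'m) set \<Rightarrow> (real^'m \<Rightarrow> real) \<Rightarrow> bool" where
  "continuous_on U g \<Longrightarrow>
   (\<And>i. \<exists>g'. (\<forall>x\<in>U. ((\<lambda>t. g (x + t *\<^sub>R axis i 1)) has_real_derivative g' x) (at 0))
              \<and> smooth_on U g') \<Longrightarrow>
   smooth_on U g"

definition smooth_map_on :: "(real^'m) set \<Rightarrow> (real^'m \<Rightarrow> real^'n) \<Rightarrow> bool" where
  "smooth_map_on U F \<longleftrightarrow> (\<forall>i. smooth_on U (\<lambda>x. F x $ i))"

definition submanifold :: "(real^'n) set \<Rightarrow> bool" where
  "submanifold S \<longleftrightarrow>
    (\<forall>s\<in>S. \<exists>U V (\<Phi>::real^'n \<Rightarrow> real^'n) \<Psi> (D::'n set).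
       open U \<and> s \<in> U \<and> open V \<and> \<Phi> ` U = V \<and> \<Psi> ` V = U \<and>
       (\<forall>x\<in>U. \<Psi> (\<Phi> x) = x) \<and> (\<forall>y\<in>V. \<Phi> (\<Psi> y) = y) \<and>
       smooth_map_on U \<Phi> \<and> smooth_map_on V \<Psi> \<and>
       \<Phi> ` (S \<inter> U) = V \<inter> {y. \<forall>i. i \<notin> D \<longrightarrow> y $ i = 0})"

definition tangent_space :: "(real^'n) set \<Rightarrow> real^'n \<Rightarrow> (real^'n) set" where
  "tangent_space S s = {v. \<exists>\<gamma>::real \<Rightarrow> real^'n. (\<forall>t. \<gamma> t \<in> S) \<and> \<gamma> 0 = s \<and>
                              (\<gamma> has_vector_derivative v) (at 0)}"

text \<open>The upper half space {x_k \<ge> 0}, with k the distinguished (m-th) coordinate.\<close>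
definition half_space :: "'m \<Rightarrow> (real^'m) set" where
  "half_space k = {x. x $ k \<ge> 0}"

definition half_space_boundary :: "'m \<Rightarrow> (real^'m) set" where
  "half_space_boundary k = {x. x $ k = 0}"

definition half_space_interior :: "'m \<Rightarrow> (real^'m) set" where
  "half_space_interior k = {x. x $ k > 0}"

section \<open>Energy density and stress tensor, in terms of the images W j = du(e j) of a
g-orthonormal frame\<close>

definition grad_sq :: "('m::finite \<Rightarrow> real^'n) \<Rightarrow> real" where
  "grad_sq W = (\<Sum>j\<in>UNIV. (norm (W j))^2)"

definition pullback_sq :: "('m::finite \<Rightarrow> real^'n) \<Rightarrow> real" where
  "pullback_sq W = (\<Sum>i\<in>UNIV. \<Sum>j\<in>UNIV. (W i \<bullet> W j)^2)"

definition energy_density ::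
  "real \<Rightarrow> real \<Rightarrow> ('m::finite \<Rightarrow> real^'n::finite) \<Rightarrow> real^'n \<Rightarrow> real" where
  "energy_density p \<epsilon> W y =
     1 / (2*p) * ((real CARD('m) - 2*p) / p^2 * (grad_sq W) powr p
                  + (real CARD('m)) powr (p/2 - 1) * (pullback_sq W) powr (p/2))
     + 1 / (4 * \<epsilon> ^ CARD('n)) * (1 - (norm y)^2)^2"

definition sigma_frame ::
  "real \<Rightarrow> ('m::finite \<Rightarrow> real^'n) \<Rightarrow> 'm \<Rightarrow> real^'n" where
  "sigma_frame p W k =
     ((real CARD('m)) powr (p/2 - 1) * (pullback_sq W) powr ((p - 2)/2)) *\<^sub>R
        (\<Sum>j\<in>UNIV. (W j \<bullet> W k) *\<^sub>R W j)
     + ((real CARD('m) - 2*p) / p^2 * (grad_sq W) powr (p - 1)) *\<^sub>R W k"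

text \<open>For the conformal metric g = f g_0 the frame e_j = f^{-1/2} \<partial>_j is g-orthonormal,
so du(e_j) = f^{-1/2} \<partial>_j u, and dv_g = f^{m/2} dx.\<close>
definition frame_image ::
  "(real^'m \<Rightarrow> real) \<Rightarrow> (real^'m \<Rightarrow> real^'m \<Rightarrow> real^'n) \<Rightarrow> real^'m \<Rightarrow> 'm \<Rightarrow> real^'n" where
  "frame_image f Du x j = (1 / sqrt (f x)) *\<^sub>R Du x (axis j 1)"

definition energy_integrand ::
  "real \<Rightarrow> real \<Rightarrow> (real^'m::finite \<Rightarrow> real) \<Rightarrow> (real^'m \<Rightarrow> real) \<Rightarrow>
   (real^'m \<Rightarrow> real^'n::finite) \<Rightarrow> (real^'m \<Rightarrow> real^'m \<Rightarrow> real^'n) \<Rightarrow> real^'m \<Rightarrow> real" where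
  "energy_integrand p \<epsilon> f \<phi> u Du x =
     energy_density p \<epsilon> (frame_image f Du x) (u x) * exp (- \<phi> x) * f x powr (real CARD('m) / 2)"

text \<open>Weak form of div(sigma) + eps^{-n}(1-|u|^2)u - sigma(grad phi) = 0 tested against psi:
integrand of  \<integral> [\<Sum>_k <sigma(e_k), dpsi(e_k)> - eps^{-n}(1-|u|^2)<u,psi>] e^{-phi} dv_g.\<close>
definition weak_integrand ::
  "real \<Rightarrow> real \<Rightarrow> (real^'m::finite \<Rightarrow> real) \<Rightarrow> (real^'m \<Rightarrow> real) \<Rightarrow>
   (real^'m \<Rightarrow> real^'n::finite) \<Rightarrow> (real^'m \<Rightarrow> real^'m \<Rightarrow> real^'n) \<Rightarrow>
   (real^'m \<Rightarrow> real^'n) \<Rightarrow> (real^'m \<Rightarrow> real^'m \<Rightarrow> real^'n) \<Rightarrow> real^'m \<Rightarrow> real" where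
  "weak_integrand p \<epsilon> f \<phi> u Du \<psi> D\<psi> x =
     ((\<Sum>k\<in>UNIV. sigma_frame p (frame_image f Du x) k \<bullet> frame_image f D\<psi> x k)
      - (1 - (norm (u x))^2) / \<epsilon> ^ CARD('n) * (u x \<bullet> \<psi> x))
     * exp (- \<phi> x) * f x powr (real CARD('m) / 2)"

text \<open>u (C^1 on the closed half space, with derivative Du) is a phi-Phi_{S,p,eps} harmonic map:
the Euler--Lagrange equation holds weakly against all C^1 test maps compactly supported
in the open half space.\<close>
definition phi_Phi_harmonic ::
  "'m::finite \<Rightarrow> real \<Rightarrow> real \<Rightarrow> (real^'m \<Rightarrow> real) \<Rightarrow> (real^'m \<Rightarrow> real) \<Rightarrow>
   (real^'m \<Rightarrow> real^'n::finite) \<Rightarrow> (real^'m \<Rightarrow> real^'m \<Rightarrow> real^'n) \<Rightarrow> bool" where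
  "phi_Phi_harmonic k p \<epsilon> f \<phi> u Du \<longleftrightarrow>
    (\<forall>(\<psi>::real^'m \<Rightarrow> real^'n) D\<psi>.
       (\<forall>x. (\<psi> has_derivative D\<psi> x) (at x)) \<and>
       (\<forall>i. continuous_on UNIV (\<lambda>x. D\<psi> x (axis i 1))) \<and>
       compact (closure {x. \<psi> x \<noteq> 0}) \<and>
       closure {x. \<psi> x \<noteq> 0} \<subseteq> half_space_interior k
       \<longrightarrow> (weak_integrand p \<epsilon> f \<phi> u Du \<psi> D\<psi> has_integral 0) (half_space k))"

end

theory Submission
  imports Defs
begin

text \<open>Evaluating the hypothesis at \<open>x = 0\<close> gives \<open>2p < m\<close>, so the
  gradient part \<open>F\<close> of the energy density is convex and \<open>2p\<close>-homogeneous, while the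
  potential is convex up to a quadratic term. Convexity replaces the missing second derivatives of
  \<open>u\<close>: testing the weak equation with \<open>u(x + t g(x) e_i) - u(x)\<close> and using convexity
  together with a change of variables shows, as \<open>t\<close> tends to \<open>0\<close>, that the first inner
  variation of the energy along \<open>g e_i\<close> has a sign. Summing over \<open>i\<close> with
  \<open>g = x_i \<zeta>(x)\<close> gives a Pohozaev inequality for the radial field \<open>\<zeta>(x) x\<close>.
  The cutoff \<open>\<zeta>\<close> is the product of a logarithmic cutoff at infinity, whose gradient term is
  bounded by a small multiple of the total energy, and a cutoff near the boundary, whose gradient term
  disappears because the free boundary condition kills the radial energy flux through the boundary.
  Hence \<open>c\<close> times the energy in any box is arbitrarily small.\<close>

section \<open>Algebra of the energy density\<close>

text \<open>A solution that is only C^1 cannot be tested against its own derivatives, so the usual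
  stress-energy identity is replaced by an inequality. Convexity controls just one sign of the inner
  variation, and it is the useful one: the terms carrying derivatives of the cutoff dominate the
  radial growth terms. A deformation along one axis has Jacobian 1 + t \<partial>_i g exactly, its
  derivative being a rank-one perturbation of the identity, and the first variation is linear in the
  field, so the radial field can be assembled from its axis components after the limit. The metric
  and the density enter only through two Euclidean weights, exp(-\<phi>) f^(m/2-p) and exp(-\<phi>)
  f^(m/2). The hypothesis on c says that the radial derivative of the first weight plus m - 2p times
  it is at least c times it; since f is radially nondecreasing, the second weight satisfies the same
  bound with m. The cutoffs are removed in a definite order: the radius at infinity is fixed before
  the boundary layer is made thin, because the flux near the boundary is small uniformly only on
  bounded sets.\<close>

definition frame_density :: "real \<Rightarrow> ('m::finite \<Rightarrow> real^'n) \<Rightarrow> real" where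
  "frame_density p W =
     1 / (2*p) * ((real CARD('m) - 2*p) / p^2 * (grad_sq W) powr p
                  + (real CARD('m)) powr (p/2 - 1) * (pullback_sq W) powr (p/2))"

definition potential :: "real \<Rightarrow> real^'n \<Rightarrow> real" where
  "potential \<kappa> y = \<kappa> / 4 * (1 - (norm y)^2)^2"

lemma grad_sq_nonneg: "grad_sq W \<ge> 0"
  by (simp add: grad_sq_def sum_nonneg)

lemma pullback_sq_nonneg: "pullback_sq W \<ge> 0"
  by (simp add: pullback_sq_def sum_nonneg)

lemma norm_le_grad_sq: "norm (W j) \<le> sqrt (grad_sq W)"
  unfolding grad_sq_def by (intro real_le_rsqrt member_le_sum) auto

lemma norm_mult_le_grad_sq: "norm (W i) * norm (W j) \<le> grad_sq W"
proof -
  have "norm (W i) * norm (W j) \<le> sqrt (grad_sq W) * sqrt (grad_sq W)"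
    by (intro mult_mono norm_le_grad_sq) (auto simp: grad_sq_nonneg)
  then show ?thesis by (simp add: grad_sq_nonneg)
qed

lemma sum_sq_sum_eq_grad_sq_sq:
  "(\<Sum>i\<in>UNIV. \<Sum>j\<in>UNIV. (norm (W i) * norm (W j))^2) = (grad_sq W)^2"
  by (simp add: grad_sq_def power2_eq_square[of "sum _ _"] sum_product power_mult_distrib)

lemma pullback_sq_le: "pullback_sq W \<le> (grad_sq W)^2"
proof -
  have "(W i \<bullet> W j)^2 \<le> (norm (W i) * norm (W j))^2" for i j
    by (metis Cauchy_Schwarz_ineq2 abs_ge_zero power2_abs power_mono)
  then show ?thesis
    unfolding pullback_sq_def sum_sq_sum_eq_grad_sq_sq[symmetric] by (intro sum_mono)
qed

lemma pullback_sq_eq_0: "pullback_sq W = 0 \<Longrightarrow> W j = 0"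
proof -
  assume "pullback_sq W = 0"
  moreover have "(W j \<bullet> W j)^2 \<le> (\<Sum>l\<in>UNIV. (W j \<bullet> W l)^2)"
    by (rule member_le_sum) auto
  moreover have "\<dots> \<le> pullback_sq W"
    unfolding pullback_sq_def
    by (rule member_le_sum[where f="\<lambda>i. \<Sum>l\<in>UNIV. (W i \<bullet> W l)^2"]) (auto simp: sum_nonneg)
  ultimately have "(W j \<bullet> W j)^2 \<le> 0" by linarith
  then show ?thesis by simp
qed

lemma Cauchy_Schwarz_double_sum:
  fixes a b :: "'a::finite \<Rightarrow> 'b::finite \<Rightarrow> real"
  shows "(\<Sum>i\<in>UNIV. \<Sum>j\<in>UNIV. a i j * b i j) \<le>
    sqrt (\<Sum>i\<in>UNIV. \<Sum>j\<in>UNIV. (a i j)^2) * sqrt (\<Sum>i\<in>UNIV. \<Sum>j\<in>UNIV. (b i j)^2)"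
proof -
  have "(\<Sum>z\<in>UNIV. (\<lambda>(i,j). a i j) z * (\<lambda>(i,j). b i j) z) \<le>
    L2_set (\<lambda>(i,j). a i j) UNIV * L2_set (\<lambda>(i,j). b i j) UNIV"
    by (rule order_trans[OF _ L2_set_mult_ineq]) (intro sum_mono, auto simp: abs_mult[symmetric])
  then show ?thesis
    by (simp add: L2_set_def sum.cartesian_product case_prod_unfold power2_eq_square
        flip: UNIV_Times_UNIV)
qed

text \<open>The mixed term is the trace of the product of the Gram matrices on the other side,
  which is where the Schatten 4-norm enters.\<close>

lemma sum_mixed_inner_sq:
  fixes A B :: "'m::finite \<Rightarrow> real^'n::finite"
  shows "(\<Sum>i\<in>UNIV. \<Sum>j\<in>UNIV. (A i \<bullet> B j)^2) =
    (\<Sum>a\<in>UNIV. \<Sum>b\<in>UNIV. (\<Sum>i\<in>UNIV. A i $ a * A i $ b) * (\<Sum>j\<in>UNIV. B j $ a * B j $ b))"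
proof -
  have "(\<Sum>i\<in>UNIV. \<Sum>j\<in>UNIV. (A i \<bullet> B j)^2) =
    (\<Sum>i\<in>UNIV. \<Sum>j\<in>UNIV. \<Sum>a\<in>UNIV. \<Sum>b\<in>UNIV. (A i $ a * A i $ b) * (B j $ a * B j $ b))"
    by (simp add: inner_vec_def power2_eq_square sum_product mult_ac)
  also have "\<dots> = (\<Sum>i\<in>UNIV. \<Sum>a\<in>UNIV. \<Sum>j\<in>UNIV. \<Sum>b\<in>UNIV. (A i $ a * A i $ b) * (B j $ a * B j $ b))"
    by (intro sum.cong refl sum.swap)
  also have "\<dots> = (\<Sum>i\<in>UNIV. \<Sum>a\<in>UNIV. \<Sum>b\<in>UNIV. \<Sum>j\<in>UNIV. (A i $ a * A i $ b) * (B j $ a * B j $ b))"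
    by (intro sum.cong refl sum.swap)
  also have "\<dots> = (\<Sum>a\<in>UNIV. \<Sum>i\<in>UNIV. \<Sum>b\<in>UNIV. \<Sum>j\<in>UNIV. (A i $ a * A i $ b) * (B j $ a * B j $ b))"
    by (rule sum.swap)
  also have "\<dots> = (\<Sum>a\<in>UNIV. \<Sum>b\<in>UNIV. \<Sum>i\<in>UNIV. \<Sum>j\<in>UNIV. (A i $ a * A i $ b) * (B j $ a * B j $ b))"
    by (intro sum.cong refl sum.swap)
  finally show ?thesis by (simp add: sum_product)
qed

text \<open>Cauchy-Schwarz for the Frobenius product of the two Gram matrices in the target. Taking
  both families equal in \<open>sum_mixed_inner_sq\<close> shows that the squared Frobenius norm of
  each matrix is \<open>pullback_sq\<close>.\<close>

lemma sum_mixed_inner_sq_le: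
  fixes A B :: "'m::finite \<Rightarrow> real^'n::finite"
  shows "(\<Sum>i\<in>UNIV. \<Sum>j\<in>UNIV. (A i \<bullet> B j)^2) \<le> sqrt (pullback_sq A) * sqrt (pullback_sq B)"
proof -
  have *: "pullback_sq W = (\<Sum>a\<in>UNIV. \<Sum>b\<in>UNIV. (\<Sum>i\<in>UNIV. W i $ a * W i $ b)^2)"
    for W :: "'m \<Rightarrow> real^'n"
    unfolding pullback_sq_def sum_mixed_inner_sq by (simp add: power2_eq_square)
  show ?thesis
    unfolding sum_mixed_inner_sq[of A B] *
    by (rule Cauchy_Schwarz_double_sum)
qed

text \<open>Hoelder's inequality for Schatten 4-norms, whose fourth power is
  \<open>pullback_sq\<close>: three factors come from \<open>B\<close> and one from
  \<open>A\<close>, hence the exponents 3/4 and 1/4. Two uses of Cauchy-Schwarz give it without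
  singular values.\<close>

lemma sum_gram_mixed_le:
  fixes A B :: "'m::finite \<Rightarrow> real^'n::finite"
  shows "(\<Sum>k\<in>UNIV. \<Sum>j\<in>UNIV. (B j \<bullet> B k) * (B j \<bullet> A k)) \<le>
    pullback_sq B powr (3/4) * pullback_sq A powr (1/4)"
proof -
  have "(\<Sum>k\<in>UNIV. \<Sum>j\<in>UNIV. (B j \<bullet> B k) * (B j \<bullet> A k)) \<le>
    sqrt (\<Sum>k\<in>UNIV. \<Sum>j\<in>UNIV. (B j \<bullet> B k)^2) * sqrt (\<Sum>k\<in>UNIV. \<Sum>j\<in>UNIV. (B j \<bullet> A k)^2)"
    by (rule Cauchy_Schwarz_double_sum)
  also have "\<dots> = sqrt (pullback_sq B) * sqrt (\<Sum>j\<in>UNIV. \<Sum>k\<in>UNIV. (A j \<bullet> B k)^2)"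
    by (simp add: pullback_sq_def inner_commute)
  also have "\<dots> \<le> sqrt (pullback_sq B) * sqrt (sqrt (pullback_sq A) * sqrt (pullback_sq B))"
    by (intro mult_left_mono real_sqrt_le_mono sum_mixed_inner_sq_le) (simp add: pullback_sq_nonneg)
  also have "\<dots> = pullback_sq B powr (3/4) * pullback_sq A powr (1/4)"
  proof -
    have "sqrt (pullback_sq B) * sqrt (sqrt (pullback_sq B)) = pullback_sq B powr (1/2) * pullback_sq B powr (1/4)"
      by (simp add: powr_half_sqrt[symmetric] pullback_sq_nonneg powr_powr)
    also have "\<dots> = pullback_sq B powr (3/4)"
      by (simp add: powr_add[symmetric])
    finally have 1: "sqrt (pullback_sq B) * sqrt (sqrt (pullback_sq B)) = pullback_sq B powr (3/4)" .
    have 2: "sqrt (sqrt (pullback_sq A)) = pullback_sq A powr (1/4)"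
      by (simp add: powr_half_sqrt[symmetric] pullback_sq_nonneg powr_powr)
    show ?thesis unfolding real_sqrt_mult using 1 2 by (simp add: mult_ac)
  qed
  finally show ?thesis .
qed

text \<open>Young's inequality for the exponents r and r/(r-1), with its exact weights. For r = 2p
  these weights match Euler's identity, so that no constant is lost in the convexity
  estimate.\<close>

lemma Young_power_ineq:
  fixes a b r :: real
  assumes "a \<ge> 0" "b \<ge> 0" "r > 1"
  shows "b powr (r - 1) * a \<le> a powr r / r + (r - 1) / r * b powr r"
proof -
  have "b powr (r - 1) * a = a * b powr (r - 1)" by simp
  also have "\<dots> \<le> a powr r / r + (b powr (r-1)) powr (r/(r-1)) / (r/(r-1))"
    using assms by (intro Youngs_inequality) (auto simp: field_simps)
  also have "(b powr (r-1)) powr (r/(r-1)) = b powr r"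
    using assms by (simp add: powr_powr)
  finally show ?thesis by (simp add: mult.commute)
qed

context
  fixes p :: real
  assumes p2: "2 \<le> p"
begin

lemma sigma_frame_inner_sum:
  fixes A B :: "'m::finite \<Rightarrow> real^'n::finite"
  shows "(\<Sum>k\<in>UNIV. sigma_frame p B k \<bullet> A k) =
    (real CARD('m)) powr (p/2 - 1) * pullback_sq B powr ((p - 2)/2) *
       (\<Sum>k\<in>UNIV. \<Sum>j\<in>UNIV. (B j \<bullet> B k) * (B j \<bullet> A k))
    + (real CARD('m) - 2*p) / p^2 * grad_sq B powr (p - 1) * (\<Sum>k\<in>UNIV. B k \<bullet> A k)"
  unfolding sigma_frame_def
  by (simp only: inner_add_left inner_sum_left inner_scaleR_left sum.distrib sum_distrib_left)

text \<open>Euler's identity: \<open>sigma_frame\<close> is the gradient of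
  \<open>frame_density\<close>, which is homogeneous of degree 2p.\<close>

lemma sigma_frame_Euler:
  fixes B :: "'m::finite \<Rightarrow> real^'n::finite"
  shows "(\<Sum>k\<in>UNIV. sigma_frame p B k \<bullet> B k) = 2 * p * frame_density p B"
proof -
  have 1: "(\<Sum>k\<in>UNIV. \<Sum>j\<in>UNIV. (B j \<bullet> B k) * (B j \<bullet> B k)) = pullback_sq B"
    unfolding pullback_sq_def power2_eq_square by (rule sum.swap)
  have 2: "(\<Sum>k\<in>UNIV. B k \<bullet> B k) = grad_sq B"
    unfolding grad_sq_def by (simp add: power2_norm_eq_inner)
  have 3: "pullback_sq B powr ((p - 2)/2) * pullback_sq B = pullback_sq B powr (p/2)"
    using p2 pullback_sq_nonneg[of B]
    by (cases "pullback_sq B = 0") (simp_all add: powr_mult_base mult.commute diff_divide_distrib)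
  have 4: "grad_sq B powr (p - 1) * grad_sq B = grad_sq B powr p"
    using p2 grad_sq_nonneg[of B]
    by (cases "grad_sq B = 0") (simp_all add: powr_mult_base mult.commute)
  show ?thesis
    unfolding sigma_frame_inner_sum 1 2 mult.assoc 3 4 frame_density_def using p2 by simp
qed

text \<open>No second derivative enters. Hoelder and Young, applied to the two terms separately,
  bound <sigma(B), A> by F(A) + (2p-1) F(B), and Euler's identity <sigma(B), B> = 2p F(B) turns this
  into the tangent inequality. The hypothesis makes the coefficient of the \<open>grad_sq\<close>
  term nonnegative.\<close>

lemma frame_density_convex:
  fixes A B :: "'m::finite \<Rightarrow> real^'n::finite"
  assumes m: "2 * p \<le> real CARD('m)"
  shows "frame_density p B + (\<Sum>k\<in>UNIV. sigma_frame p B k \<bullet> (A k - B k)) \<le> frame_density p A"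
proof -
  let ?a = "(real CARD('m) - 2*p) / p^2" and ?b = "(real CARD('m)) powr (p/2 - 1)"
  define NA NB QA QB where "NA = grad_sq A" and "NB = grad_sq B"
    and "QA = pullback_sq A" and "QB = pullback_sq B"
  have nn: "NA \<ge> 0" "NB \<ge> 0" "QA \<ge> 0" "QB \<ge> 0"
    unfolding NA_def NB_def QA_def QB_def by (auto simp: grad_sq_nonneg pullback_sq_nonneg)
  have *: "b * (y / (2*p) + (2*p - 1)/(2*p) * y') + a * (x / (2*p) + (2*p - 1)/(2*p) * x') =
    1 / (2*p) * (a * x + b * y) + (2*p - 1) * (1 / (2*p) * (a * x' + b * y'))" for a b x y x' y' :: real
    by (simp add: algebra_simps add_divide_distrib diff_divide_distrib)
  have "QB powr ((p - 2)/2) * (\<Sum>k\<in>UNIV. \<Sum>j\<in>UNIV. (B j \<bullet> B k) * (B j \<bullet> A k))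
      \<le> QB powr ((p - 2)/2) * (QB powr (3/4) * QA powr (1/4))"
    unfolding QA_def QB_def by (intro mult_left_mono sum_gram_mixed_le) auto
  also have "\<dots> = (QB powr (1/4)) powr (2*p - 1) * QA powr (1/4)"
    by (simp add: powr_powr powr_add[symmetric] field_simps)
  also have "\<dots> \<le> (QA powr (1/4)) powr (2*p) / (2*p) + (2*p - 1)/(2*p) * (QB powr (1/4)) powr (2*p)"
    using p2 by (intro Young_power_ineq) auto
  also have "\<dots> = QA powr (p/2) / (2*p) + (2*p - 1)/(2*p) * QB powr (p/2)"
    by (simp add: powr_powr)
  finally have Q: "QB powr ((p - 2)/2) * (\<Sum>k\<in>UNIV. \<Sum>j\<in>UNIV. (B j \<bullet> B k) * (B j \<bullet> A k))
      \<le> QA powr (p/2) / (2*p) + (2*p - 1)/(2*p) * QB powr (p/2)" .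
  have "(\<Sum>k\<in>UNIV. B k \<bullet> A k) \<le> (\<Sum>k\<in>UNIV. \<bar>norm (B k)\<bar> * \<bar>norm (A k)\<bar>)"
    by (intro sum_mono) (simp add: norm_cauchy_schwarz)
  also have "\<dots> \<le> sqrt NB * sqrt NA"
    using L2_set_mult_ineq[of "\<lambda>k. norm (B k)" "\<lambda>k. norm (A k)" UNIV]
    by (simp add: L2_set_def NA_def NB_def grad_sq_def)
  finally have "NB powr (p - 1) * (\<Sum>k\<in>UNIV. B k \<bullet> A k) \<le> NB powr (p-1) * (sqrt NB * sqrt NA)"
    by (intro mult_left_mono) auto
  also have "\<dots> = (NB powr (1/2)) powr (2*p - 1) * NA powr (1/2)"
    by (simp add: powr_half_sqrt[symmetric] nn powr_powr powr_add[symmetric] field_simps)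
  also have "\<dots> \<le> (NA powr (1/2)) powr (2*p) / (2*p) + (2*p - 1)/(2*p) * (NB powr (1/2)) powr (2*p)"
    using p2 by (intro Young_power_ineq) auto
  also have "\<dots> = NA powr p / (2*p) + (2*p - 1)/(2*p) * NB powr p"
    by (simp add: powr_powr)
  finally have N: "NB powr (p - 1) * (\<Sum>k\<in>UNIV. B k \<bullet> A k)
      \<le> NA powr p / (2*p) + (2*p - 1)/(2*p) * NB powr p" .
  have "(\<Sum>k\<in>UNIV. sigma_frame p B k \<bullet> A k) \<le>
     ?b * (QA powr (p/2) / (2*p) + (2*p - 1)/(2*p) * QB powr (p/2))
     + ?a * (NA powr p / (2*p) + (2*p - 1)/(2*p) * NB powr p)"
    unfolding sigma_frame_inner_sum mult.assoc NB_def[symmetric] QB_def[symmetric]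
    by (intro add_mono mult_left_mono[OF Q] mult_left_mono[OF N]) (use m in auto)
  also have "\<dots> = frame_density p A + (2*p - 1) * frame_density p B"
    unfolding frame_density_def NA_def[symmetric] NB_def[symmetric] QA_def[symmetric] QB_def[symmetric]
    by (rule *)
  finally show ?thesis
    using sigma_frame_Euler[of B] by (simp add: inner_diff_right sum_subtractf algebra_simps)
qed

lemma frame_density_ge:
  fixes B :: "'m::finite \<Rightarrow> real^'n::finite"
  shows "(real CARD('m) - 2*p) / p^2 * grad_sq B powr p \<le> 2 * p * frame_density p B"
  unfolding frame_density_def using p2 by simp

lemma frame_density_nonneg:
  fixes B :: "'m::finite \<Rightarrow> real^'n::finite"
  assumes m: "2 * p \<le> real CARD('m)"
  shows "frame_density p B \<ge> 0"
  unfolding frame_density_def using p2 m by simp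

lemma frame_density_eq_0D:
  fixes B :: "'m::finite \<Rightarrow> real^'n::finite"
  assumes m: "2 * p < real CARD('m)" and "frame_density p B = 0"
  shows "B j = 0"
proof -
  have "(real CARD('m) - 2*p) / p^2 * grad_sq B powr p \<le> 0"
    using frame_density_ge[of B] assms by simp
  moreover have "(real CARD('m) - 2*p) / p^2 > 0" using m p2 by simp
  ultimately have "grad_sq B powr p \<le> 0" by (metis mult_le_0_iff not_le)
  then have "grad_sq B = 0" by simp
  then show ?thesis using norm_le_grad_sq[of B j] by simp
qed

text \<open>Growth of degree 2p: \<open>pullback_sq\<close> is at most the square of
  \<open>grad_sq\<close>, so the pullback term is dominated by the same power of
  \<open>grad_sq\<close> as the other one.\<close>

lemma norm_sigma_frame_le:
  fixes B :: "'m::finite \<Rightarrow> real^'n::finite"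
  assumes m: "2 * p \<le> real CARD('m)"
  shows "norm (sigma_frame p B k) * norm (B l) \<le>
    ((real CARD('m)) powr (p/2 - 1) + (real CARD('m) - 2*p) / p^2) * grad_sq B powr p"
proof -
  let ?a = "(real CARD('m) - 2*p) / p^2" and ?b = "(real CARD('m)) powr (p/2 - 1)"
  define N where "N = grad_sq B"
  have N: "N \<ge> 0" unfolding N_def by (rule grad_sq_nonneg)
  have Q: "pullback_sq B powr ((p-2)/2) \<le> N powr (p - 2)"
  proof -
    have "pullback_sq B powr ((p-2)/2) \<le> (N^2) powr ((p-2)/2)"
      unfolding N_def using p2 by (intro powr_mono2 pullback_sq_le pullback_sq_nonneg) auto
    also have "\<dots> = N powr (p - 2)" using N by (simp add: powr_powr diff_divide_distrib flip: powr_numeral)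
    finally show ?thesis .
  qed
  have "norm (\<Sum>j\<in>UNIV. (B j \<bullet> B k) *\<^sub>R B j) \<le> (\<Sum>j\<in>UNIV. \<bar>B j \<bullet> B k\<bar> * norm (B j))"
    by (rule sum_norm_le) simp
  also have "\<dots> \<le> (\<Sum>j\<in>UNIV. (norm (B j))^2 * norm (B k))"
  proof (rule sum_mono)
    fix j
    have "\<bar>B j \<bullet> B k\<bar> * norm (B j) \<le> (norm (B j) * norm (B k)) * norm (B j)"
      by (intro mult_right_mono Cauchy_Schwarz_ineq2) auto
    then show "\<bar>B j \<bullet> B k\<bar> * norm (B j) \<le> (norm (B j))^2 * norm (B k)"
      by (simp add: power2_eq_square mult_ac)
  qed
  also have "\<dots> = N * norm (B k)" by (simp add: N_def grad_sq_def sum_distrib_right)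
  finally have S: "norm (\<Sum>j\<in>UNIV. (B j \<bullet> B k) *\<^sub>R B j) \<le> N * norm (B k)" .
  have "norm (sigma_frame p B k) \<le> ?b * pullback_sq B powr ((p-2)/2) * norm (\<Sum>j\<in>UNIV. (B j \<bullet> B k) *\<^sub>R B j)
     + ?a * N powr (p-1) * norm (B k)"
    unfolding sigma_frame_def using m
    by (intro order_trans[OF norm_triangle_ineq]) (simp add: N_def abs_mult)
  also have "\<dots> \<le> ?b * N powr (p-2) * (N * norm (B k)) + ?a * N powr (p-1) * norm (B k)"
    using m N by (intro add_mono mult_mono mult_left_mono Q S order_refl) auto
  finally have "norm (sigma_frame p B k) * norm (B l) \<le>
    (?b * N powr (p-2) * (N * norm (B k)) + ?a * N powr (p-1) * norm (B k)) * norm (B l)"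
    by (rule mult_right_mono) simp
  also have "\<dots> = (?b * (N powr (p-2) * N) + ?a * N powr (p-1)) * (norm (B k) * norm (B l))"
    by (simp add: algebra_simps)
  also have "\<dots> \<le> (?b * (N powr (p-2) * N) + ?a * N powr (p-1)) * N"
    using m N unfolding N_def
    by (intro mult_left_mono norm_mult_le_grad_sq add_nonneg_nonneg mult_nonneg_nonneg) auto
  also have "\<dots> = (?b + ?a) * N powr p"
  proof (cases "N = 0")
    case False
    then have "N powr (p-2) * N = N powr (p-1)" "N powr (p-1) * N = N powr p"
      using N powr_add[of N "p-2" 1] powr_add[of N "p-1" 1] by auto
    then show ?thesis by (metis distrib_right mult.assoc)
  qed simp
  finally show ?thesis unfolding N_def .
qed

text \<open>The constant does not depend on the frame, so stress terms can be absorbed pointwise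
  into the energy. The strict inequality 2p < m lets the first term of the density alone control
  \<open>grad_sq B powr p\<close>.\<close>

lemma sigma_frame_inner_le:
  assumes m: "2 * p < real CARD('m)"
  obtains C where "C \<ge> 0"
    "\<And>(B :: 'm::finite \<Rightarrow> real^'n::finite) k l. \<bar>sigma_frame p B k \<bullet> B l\<bar> \<le> C * frame_density p B"
proof -
  let ?a = "(real CARD('m) - 2*p) / p^2" and ?b = "(real CARD('m)) powr (p/2 - 1)"
  have a: "?a > 0" using m p2 by simp
  show ?thesis
  proof
    show "(?b + ?a) * (2 * p / ?a) \<ge> 0" using m p2 by (intro mult_nonneg_nonneg add_nonneg_nonneg divide_nonneg_nonneg) auto
    fix B :: "'m \<Rightarrow> real^'n" and k l
    have "\<bar>sigma_frame p B k \<bullet> B l\<bar> \<le> norm (sigma_frame p B k) * norm (B l)"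
      by (rule Cauchy_Schwarz_ineq2)
    also have "\<dots> \<le> (?b + ?a) * grad_sq B powr p"
      using m by (intro norm_sigma_frame_le) auto
    also have "\<dots> \<le> (?b + ?a) * (2 * p * frame_density p B / ?a)"
    proof (rule mult_left_mono)
      show "grad_sq B powr p \<le> 2 * p * frame_density p B / ?a"
        unfolding pos_le_divide_eq[OF a] using frame_density_ge[of B] by (simp only: mult.commute)
      show "?b + ?a \<ge> 0" using a by (intro add_nonneg_nonneg) auto
    qed
    finally show "\<bar>sigma_frame p B k \<bullet> B l\<bar> \<le> (?b + ?a) * (2 * p / ?a) * frame_density p B"
      by (simp add: mult_ac)
  qed
qed

lemma continuous_on_grad_sq:
  assumes "\<And>j. continuous_on S (\<lambda>z. W z j)"
  shows "continuous_on S (\<lambda>z. grad_sq (W z))"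
  unfolding grad_sq_def by (intro continuous_intros assms)

lemma continuous_on_pullback_sq:
  assumes "\<And>j. continuous_on S (\<lambda>z. W z j)"
  shows "continuous_on S (\<lambda>z. pullback_sq (W z))"
  unfolding pullback_sq_def by (intro continuous_intros assms)

lemma continuous_on_frame_density:
  assumes "\<And>j. continuous_on S (\<lambda>z. W z j)"
  shows "continuous_on S (\<lambda>z. frame_density p (W z))"
proof -
  have "continuous_on S (\<lambda>z. grad_sq (W z) powr p)" "continuous_on S (\<lambda>z. pullback_sq (W z) powr (p/2))"
    using p2 continuous_on_grad_sq[OF assms] continuous_on_pullback_sq[OF assms]
    by (auto intro!: continuous_on_powr' simp: grad_sq_nonneg pullback_sq_nonneg)
  then show ?thesis unfolding frame_density_def by (intro continuous_on_add continuous_on_mult continuous_on_const)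
qed

text \<open>For \<open>p = 2\<close> the factor \<open>pullback_sq W powr ((p - 2)/2)\<close> jumps to \<open>0\<close> at
  \<open>W = 0\<close>, where the other factor vanishes.\<close>

lemma continuous_on_sigma_frame:
  fixes W :: "'a::topological_space \<Rightarrow> 'b::finite \<Rightarrow> real^'c::finite"
  assumes W: "\<And>j. continuous_on S (\<lambda>z. W z j)"
  shows "continuous_on S (\<lambda>z. sigma_frame p (W z) k)"
proof -
  have N: "continuous_on S (\<lambda>z. grad_sq (W z) powr (p - 1))"
    using p2 continuous_on_grad_sq[OF W] by (auto intro!: continuous_on_powr' simp: grad_sq_nonneg)
  have V: "continuous_on S (\<lambda>z. \<Sum>j\<in>UNIV. (W z j \<bullet> W z k) *\<^sub>R W z j)"
    by (intro continuous_intros W)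
  show ?thesis
  proof (cases "p = 2")
    case False
    then have "continuous_on S (\<lambda>z. pullback_sq (W z) powr ((p - 2)/2))"
      using p2 continuous_on_pullback_sq[OF W]
      by (auto intro!: continuous_on_powr' simp: pullback_sq_nonneg)
    then show ?thesis
      unfolding sigma_frame_def
      by (intro continuous_on_add continuous_on_scaleR continuous_on_mult continuous_on_const V N W)
  next
    case True
    have "sigma_frame p B k = (\<Sum>j\<in>UNIV. (B j \<bullet> B k) *\<^sub>R B j)
      + ((real CARD('b) - 2*p) / p^2 * (grad_sq B) powr (p - 1)) *\<^sub>R B k" for B :: "'b \<Rightarrow> real^'c"
      unfolding sigma_frame_def using pullback_sq_eq_0[of B] by (cases "pullback_sq B = 0") (auto simp: True)
    then show ?thesis
      by (simp only:) (intro continuous_on_add continuous_on_scaleR continuous_on_mult continuous_on_const V N W)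
  qed
qed

end

section \<open>The double-well potential\<close>

lemma potential_nonneg: "\<kappa> \<ge> 0 \<Longrightarrow> potential \<kappa> y \<ge> 0"
  by (simp add: potential_def)

text \<open>Adding \<kappa>/2 |y|^2 to the potential gives \<kappa>/4 (1 + |y|^4), which is convex;
  its tangent inequality is the claim. The error is quadratic in z - y and therefore disappears in
  the first variation.\<close>

lemma potential_semiconvex:
  assumes "\<kappa> \<ge> 0"
  shows "potential \<kappa> y - (1 - (norm y)^2) * \<kappa> * (y \<bullet> (z - y)) \<le>
    potential \<kappa> z + \<kappa> / 2 * (norm (z - y))^2"
proof -
  have *: "(norm (z - y))^2 = (norm z)^2 - (norm y)^2 - 2 * (y \<bullet> (z - y))"
    by (simp add: power2_norm_eq_inner inner_diff_left inner_diff_right inner_commute)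
  define a b d where "a = (norm z)^2" and "b = (norm y)^2" and "d = y \<bullet> (z - y)"
  have nn: "0 \<le> a - b - 2*d" "0 \<le> b"
    using * zero_le_power2[of "norm (z-y)"] unfolding a_def b_def d_def by auto
  \<comment> \<open>The defect is a sum of nonnegative terms, since a - b - 2*d is the squared norm
    of z - y.\<close>
  have "potential \<kappa> z + \<kappa> / 2 * (norm (z - y))^2 - (potential \<kappa> y - (1 - (norm y)^2) * \<kappa> * (y \<bullet> (z - y)))
    = \<kappa> / 4 * ((a - b)^2 + 2 * (b * (a - b - 2*d)))"
    unfolding potential_def * a_def[symmetric] b_def[symmetric] d_def[symmetric]
    by (simp add: power2_eq_square field_simps)
  moreover have "\<dots> \<ge> 0" using assms nn by (intro mult_nonneg_nonneg add_nonneg_nonneg) auto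
  ultimately show ?thesis by linarith
qed

lemma continuous_on_potential: "continuous_on S v \<Longrightarrow> continuous_on S (\<lambda>z. potential \<kappa> (v z))"
  unfolding potential_def by (intro continuous_intros)

section \<open>Shear change of variables\<close>

text \<open>A finite type with as many elements as the index type, ordered like the naturals below
  its cardinality. It stands in for the index type where coordinates have to be
  well-ordered.\<close>

typedef 'a rank = "{..<CARD('a::finite)}"
  by (rule exI[of _ 0]) simp

instantiation rank :: (finite) wellorder
begin

definition less_eq_rank :: "'a rank \<Rightarrow> 'a rank \<Rightarrow> bool" where
  "less_eq_rank a b \<longleftrightarrow> Rep_rank a \<le> Rep_rank b"

definition less_rank :: "'a rank \<Rightarrow> 'a rank \<Rightarrow> bool" where
  "less_rank a b \<longleftrightarrow> Rep_rank a < Rep_rank b"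

instance
proof
  fix P :: "'a rank \<Rightarrow> bool" and a
  assume step: "\<And>x. (\<And>y. y < x \<Longrightarrow> P y) \<Longrightarrow> P x"
  show "P a"
    by (induction a rule: measure_induct_rule[of Rep_rank]) (auto intro: step simp: less_rank_def)
qed (auto simp: less_eq_rank_def less_rank_def Rep_rank_inject)

end

instance rank :: (finite) finite
proof
  show "finite (UNIV :: 'a rank set)"
    using type_definition.univ[OF type_definition_rank] by (metis finite_imageI finite_lessThan)
qed

lemma ex_bij_rank: "\<exists>\<pi> :: 'a::finite rank \<Rightarrow> 'a. bij \<pi>"
proof -
  have "CARD('a rank) = CARD('a)"
    using type_definition.card[OF type_definition_rank] by simp
  then show ?thesis
    using finite_same_card_bij[of "UNIV :: 'a rank set" "UNIV :: 'a set"] by auto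
qed

text \<open>A relabelling of coordinates maps boxes to boxes and keeps the product of the side
  lengths, so it preserves the integral over every box. The integral over the whole space is then
  the limit over large boxes.\<close>

lemma has_integral_permute_coordinates:
  fixes \<pi> :: "'b::finite \<Rightarrow> 'a::finite" and h :: "real^'a \<Rightarrow> real"
  assumes \<pi>: "bij \<pi>" and h: "(h has_integral I) UNIV"
  shows "((\<lambda>y::real^'b. h (\<chi> j. y $ inv \<pi> j)) has_integral I) UNIV"
proof -
  define T :: "real^'b \<Rightarrow> real^'a" where "T y = (\<chi> j. y $ inv \<pi> j)" for y
  define T' :: "real^'a \<Rightarrow> real^'b" where "T' x = (\<chi> b. x $ \<pi> b)" for x
  have pi1: "\<pi> (inv \<pi> j) = j" for j using \<pi> by (simp add: bij_is_surj surj_f_inv_f)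
  have pi2: "inv \<pi> (\<pi> b) = b" for b using \<pi> by (simp add: bij_is_inj)
  have T: "T' (T y) = y" "T (T' x) = x" for x y
    by (auto simp: T_def T'_def vec_eq_iff pi1 pi2)
  have all_pi: "(\<forall>b. P (\<pi> b)) \<longleftrightarrow> (\<forall>j. P j)" for P by (metis pi1)
  have T'box: "T' ` cbox a b = cbox (T' a) (T' b)" for a b
  proof -
    have *: "T' x \<in> cbox (T' a) (T' b) \<longleftrightarrow> x \<in> cbox a b" for x
      using all_pi[of "\<lambda>j. a $ j \<le> x $ j \<and> x $ j \<le> b $ j"] by (simp add: T'_def mem_box_cart)
    have "y \<in> T' ` cbox a b" if "y \<in> cbox (T' a) (T' b)" for y
      using that *[of "T y"] T(1)[of y] by (metis imageI)
    then show ?thesis using * by blast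
  qed
  have Tbox: "T ` cbox a b = cbox (T a) (T b)" for a b
  proof -
    have "T ` cbox a b = T ` (T' ` cbox (T a) (T b))"
      unfolding T'box T ..
    then show ?thesis by (simp add: image_image T)
  qed
  have cont: "measure lborel (T ` cbox a b) = 1 * measure lborel (cbox a b)" for a b
  proof -
    have "(\<Prod>i\<in>UNIV. T b $ i - T a $ i) = (\<Prod>i\<in>UNIV. b $ i - a $ i)"
      unfolding T_def vec_lambda_beta using \<pi>
      by (intro prod.reindex_bij_betw[of "inv \<pi>" UNIV UNIV "\<lambda>i. b $ i - a $ i"]) (simp add: bij_imp_bij_inv)
    moreover have "cbox (T a) (T b) = {} \<longleftrightarrow> cbox a b = {}"
      using Tbox[of a b] image_is_empty[of T "cbox a b"] by simp
    ultimately show ?thesis unfolding Tbox by (simp add: content_cbox_if_cart)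
  qed
  \<comment> \<open>Norm preservation lets the same radius serve for the exhaustion by boxes on both
    sides.\<close>
  have normT: "norm (T y) = norm y" for y
  proof -
    have "(\<Sum>i\<in>UNIV. (norm (y $ inv \<pi> i))^2) = (\<Sum>i\<in>UNIV. (norm (y $ i))^2)"
      using \<pi> by (intro sum.reindex_bij_betw[of "inv \<pi>" UNIV UNIV "\<lambda>i. (norm (y $ i))^2"]) (simp add: bij_imp_bij_inv)
    then show ?thesis by (simp add: norm_vec_def L2_set_def T_def)
  qed
  have linT: "bounded_linear T"
    unfolding T_def by (intro linear_conv_bounded_linear[THEN iffD1] linearI) (auto simp: vec_eq_iff)
  have tw: "((\<lambda>x. h (T x)) has_integral i) (cbox c d)" if "(h has_integral i) (cbox (T c) (T d))" for i c d
  proof -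
    have "((\<lambda>x. h(T x)) has_integral (1 / 1) *\<^sub>R i) (T' ` cbox (T c) (T d))"
    proof (rule has_integral_twiddle[OF _ T(1) T(2) _ _ _ cont that])
      show "continuous (at x) T" for x
        using linT by (simp add: bounded_linear.isCont[OF linT])
    qed (simp, (use Tbox T'box in blast)+)
    then show ?thesis by (simp add: T'box T)
  qed
  show ?thesis unfolding T_def[symmetric]
  proof (subst has_integral', intro allI impI)
    fix e :: real assume "e > 0"
    then obtain B where B: "B > 0" "\<And>a b. ball 0 B \<subseteq> cbox a b \<Longrightarrow> \<exists>z. (h has_integral z) (cbox a b) \<and> norm (z - I) < e"
      using has_integral'[of h I UNIV] h by auto
    show "\<exists>B>0. \<forall>a b. ball 0 B \<subseteq> cbox a b \<longrightarrow>
       (\<exists>z. ((\<lambda>x. if x \<in> UNIV then h (T x) else 0) has_integral z) (cbox a b) \<and> norm (z - I) < e)"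
    proof (rule exI[of _ B], intro conjI allI impI)
      fix a b :: "real^'b" assume ab: "ball 0 B \<subseteq> cbox a b"
      have "ball 0 B \<subseteq> cbox (T a) (T b)"
      proof
        fix x assume "x \<in> ball (0::real^'a) B"
        then have "T' x \<in> ball 0 B" using normT[of "T' x"] by (simp add: T)
        then have "T (T' x) \<in> T ` cbox a b" using ab by blast
        then show "x \<in> cbox (T a) (T b)" by (simp add: T Tbox)
      qed
      then obtain z where "(h has_integral z) (cbox (T a) (T b))" "norm (z - I) < e"
        using B by blast
      then show "\<exists>z. ((\<lambda>x. if x \<in> UNIV then h (T x) else 0) has_integral z) (cbox a b) \<and> norm (z - I) < e"
        using tw[of z a b] by (intro exI[of _ z]) simp
    qed (rule B)
  qed
qed

text \<open>The matrix is the identity with row i replaced, so Cramer's lemma for rows reads off the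
  determinant as the i-th entry of the new row.\<close>

lemma det_matrix_shear:
  fixes i :: "'a::finite" and L :: "real^'a \<Rightarrow> real"
  assumes "linear L"
  shows "det (matrix (\<lambda>v. v + L v *\<^sub>R axis i 1)) = 1 + L (axis i 1)"
proof -
  let ?x = "(\<chi> j. (if j = i then 1 else 0) + L (axis j 1)) :: real^'a"
  have "(\<Sum>j\<in>UNIV. ?x $ j *s row j (mat 1 :: real^'a^'a)) = ?x"
    by (simp add: vec_eq_iff row_def mat_def if_distrib cong: if_cong)
  then have "(\<chi> l. if l = i then \<Sum>j\<in>UNIV. ?x $ j *s row j (mat 1) else row l (mat 1)) =
      matrix (\<lambda>v. v + L v *\<^sub>R axis i 1)"
    by (auto simp: vec_eq_iff matrix_def row_def mat_def axis_def)
  then show ?thesis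
    using cramer_lemma_transpose[of i ?x "mat 1"] by simp
qed

text \<open>The change of variables is an equality with the integral over the image of
  \<open>S\<close>. The inequality arises only at the end, because the image lies in
  \<open>S\<close> and \<open>h\<close> is nonnegative there.\<close>

lemma integral_shear_le_wellorder:
  fixes g :: "real^'a::{finite,wellorder} \<Rightarrow> real" and h :: "real^'a::_ \<Rightarrow> real"
  assumes S: "S \<in> sets lebesgue"
    and g: "\<And>x. x \<in> S \<Longrightarrow> (g has_derivative Dg x) (at x within S)"
    and inj: "inj_on (\<lambda>x. x + g x *\<^sub>R axis i 1) S"
    and img: "\<And>x. x \<in> S \<Longrightarrow> x + g x *\<^sub>R axis i 1 \<in> S"
    and pos: "\<And>x. x \<in> S \<Longrightarrow> 1 + Dg x (axis i 1) \<ge> 0"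
    and h: "h integrable_on S" "\<And>x. x \<in> S \<Longrightarrow> h x \<ge> 0"
  shows "(\<lambda>x. (1 + Dg x (axis i 1)) * h (x + g x *\<^sub>R axis i 1)) integrable_on S"
    "integral S (\<lambda>x. (1 + Dg x (axis i 1)) * h (x + g x *\<^sub>R axis i 1)) \<le> integral S h"
proof -
  define \<Phi> where "\<Phi> x = x + g x *\<^sub>R axis i 1" for x
  define D where "D x v = v + Dg x v *\<^sub>R axis i 1" for x v
  let ?F = "\<lambda>x. (1 + Dg x (axis i 1)) * h (\<Phi> x)"
  have der: "(\<Phi> has_derivative D x) (at x within S)" if "x \<in> S" for x
    unfolding \<Phi>_def D_def by (auto intro!: derivative_eq_intros g that)
  have sub: "\<Phi> ` S \<subseteq> S" using img by (auto simp: \<Phi>_def)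
  have meas: "\<Phi> ` S \<in> sets lebesgue"
    using der S by (intro differentiable_image_in_sets_lebesgue) (auto simp: differentiable_on_def differentiable_def)
  have hS: "h absolutely_integrable_on S"
    using h by (rule nonnegative_absolutely_integrable_1)
  have hI: "h absolutely_integrable_on (\<Phi> ` S)"
    by (rule set_integrable_subset[OF hS meas sub])
  have det: "\<bar>det (matrix (D x))\<bar> = 1 + Dg x (axis i 1)" if "x \<in> S" for x
    unfolding D_def using pos[OF that]
    by (subst det_matrix_shear) (auto intro: has_derivative_linear g that)
  \<comment> \<open>The scalar integrand is viewed as a vector with one component, the form in which
    the change of variables is applied.\<close>
  let ?v = "vec :: real \<Rightarrow> real^1"
  have hv: "(\<lambda>x. ?v (h x)) absolutely_integrable_on (\<Phi> ` S) \<and> integral (\<Phi> ` S) (\<lambda>x. ?v (h x)) = ?v (integral (\<Phi> ` S) h)"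
    using hI by (auto simp: absolutely_integrable_on_1_iff integral_on_1_eq)
  have "(\<lambda>x. \<bar>det (matrix (D x))\<bar> *\<^sub>R ?v (h (\<Phi> x))) absolutely_integrable_on S \<and>
    integral S (\<lambda>x. \<bar>det (matrix (D x))\<bar> *\<^sub>R ?v (h (\<Phi> x))) = ?v (integral (\<Phi> ` S) h)"
    using has_absolute_integral_change_of_variables[OF S der, of "\<lambda>x. ?v (h x)" "?v (integral (\<Phi> ` S) h)"] inj hv
    unfolding \<Phi>_def by blast
  then have "(\<lambda>x. \<bar>det (matrix (D x))\<bar> * h (\<Phi> x)) absolutely_integrable_on S \<and>
    integral S (\<lambda>x. \<bar>det (matrix (D x))\<bar> * h (\<Phi> x)) = integral (\<Phi> ` S) h"
    by (auto simp: absolutely_integrable_on_1_iff integral_on_1_eq)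
  then have "((\<lambda>x. \<bar>det (matrix (D x))\<bar> * h (\<Phi> x)) has_integral integral (\<Phi> ` S) h) S"
    by (auto simp: has_integral_iff set_lebesgue_integral_eq_integral)
  then have F: "(?F has_integral integral (\<Phi> ` S) h) S"
    by (rule has_integral_cong[THEN iffD1, rotated]) (simp add: det)
  have "integral (\<Phi> ` S) h \<le> integral S h"
    using hI h by (intro integral_subset_le[OF sub]) (auto simp: set_lebesgue_integral_eq_integral)
  then show "(\<lambda>x. (1 + Dg x (axis i 1)) * h (x + g x *\<^sub>R axis i 1)) integrable_on S"
    "integral S (\<lambda>x. (1 + Dg x (axis i 1)) * h (x + g x *\<^sub>R axis i 1)) \<le> integral S h"
    using F unfolding \<Phi>_def by (auto simp: has_integral_iff)
qed

text \<open>The change of variables theorem of the library is restricted to well-ordered index types;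
  permuting the coordinates removes this restriction.\<close>

lemma integral_shear_le:
  fixes g :: "real^'a::finite \<Rightarrow> real" and h :: "real^'a \<Rightarrow> real"
  assumes S: "closed S"
    and g: "\<And>x. x \<in> S \<Longrightarrow> (g has_derivative Dg x) (at x within S)"
    and inj: "inj_on (\<lambda>x. x + g x *\<^sub>R axis i 1) S"
    and img: "\<And>x. x \<in> S \<Longrightarrow> x + g x *\<^sub>R axis i 1 \<in> S"
    and pos: "\<And>x. x \<in> S \<Longrightarrow> 1 + Dg x (axis i 1) \<ge> 0"
    and h: "h integrable_on S" "\<And>x. x \<in> S \<Longrightarrow> h x \<ge> 0"
  shows "(\<lambda>x. (1 + Dg x (axis i 1)) * h (x + g x *\<^sub>R axis i 1)) integrable_on S \<and>
    integral S (\<lambda>x. (1 + Dg x (axis i 1)) * h (x + g x *\<^sub>R axis i 1)) \<le> integral S h"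
proof -
  obtain \<pi> :: "'a rank \<Rightarrow> 'a" where \<pi>: "bij \<pi>" using ex_bij_rank by blast
  define T :: "real^'a rank \<Rightarrow> real^'a" where "T y = (\<chi> j. y $ inv \<pi> j)" for y
  define T' :: "real^'a \<Rightarrow> real^'a rank" where "T' x = (\<chi> b. x $ \<pi> b)" for x
  have pi1: "\<pi> (inv \<pi> j) = j" for j using \<pi> by (simp add: bij_is_surj surj_f_inv_f)
  have pi2: "inv \<pi> (\<pi> b) = b" for b using \<pi> by (simp add: bij_is_inj)
  have T: "T' (T y) = y" "T (T' x) = x" for x y
    by (auto simp: T_def T'_def vec_eq_iff pi1 pi2)
  have linT: "bounded_linear T"
    unfolding T_def by (intro linear_conv_bounded_linear[THEN iffD1] linearI) (auto simp: vec_eq_iff)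
  have Tax: "T (axis (inv \<pi> i) 1) = axis i 1"
    using pi1 by (auto simp: T_def vec_eq_iff axis_def) (metis pi1)
  have Tsh: "T (y + c *\<^sub>R axis (inv \<pi> i) 1) = T y + c *\<^sub>R axis i 1" for y c
    using linT Tax by (simp add: linear_simps)
  have int1: "((\<lambda>y. f (T y)) has_integral I) (T -` S)" if "(f has_integral I) S" for f :: "real^'a \<Rightarrow> real" and I
  proof -
    have "((\<lambda>x. if x \<in> S then f x else 0) has_integral I) UNIV"
      using that by (simp add: has_integral_restrict_UNIV)
    from has_integral_permute_coordinates[OF \<pi> this]
    have "((\<lambda>y. if y \<in> T -` S then f (T y) else 0) has_integral I) UNIV"
      unfolding T_def by simp
    then show ?thesis by (simp only: has_integral_restrict_UNIV)
  qed
  have int2: "(f has_integral I) S" if "((\<lambda>y. f (T y)) has_integral I) (T -` S)" for f :: "real^'a \<Rightarrow> real" and I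
  proof -
    have "((\<lambda>x. if x \<in> T -` S then f (T x) else 0) has_integral I) UNIV"
      using that by (simp only: has_integral_restrict_UNIV)
    from has_integral_permute_coordinates[OF bij_imp_bij_inv[OF \<pi>] this]
    have "((\<lambda>y. if T (T' y) \<in> S then f (T (T' y)) else 0) has_integral I) UNIV"
      unfolding T'_def inv_inv_eq[OF \<pi>] by simp
    then show ?thesis by (simp add: T has_integral_restrict_UNIV)
  qed
  have eq: "integral (T -` S) (\<lambda>y. f (T y)) = integral S f" if "f integrable_on S" for f :: "real^'a \<Rightarrow> real"
    using int1[of f "integral S f"] that by (simp add: integrable_integral integral_unique)
  let ?S = "T -` S" and ?i = "inv \<pi> i"
  let ?F = "\<lambda>x. (1 + Dg x (axis i 1)) * h (x + g x *\<^sub>R axis i 1)"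
  have "closed ?S"
    by (intro continuous_closed_vimage S linear_continuous_at linT)
  then have meas: "?S \<in> sets lebesgue" by (simp add: borel_closed)
  have der: "((\<lambda>y. g (T y)) has_derivative (\<lambda>v. Dg (T y) (T v))) (at y within ?S)" if "y \<in> ?S" for y
  proof -
    have "(g has_derivative Dg (T y)) (at (T y) within T ` ?S)"
      using g[of "T y"] that by (auto intro: has_derivative_subset)
    from has_derivative_in_compose[OF bounded_linear_imp_has_derivative[OF linT] this]
    show ?thesis .
  qed
  have inj': "inj_on (\<lambda>y. y + g (T y) *\<^sub>R axis ?i 1) ?S"
  proof (rule inj_onI)
    fix y z assume yz: "y \<in> ?S" "z \<in> ?S" "y + g (T y) *\<^sub>R axis ?i 1 = z + g (T z) *\<^sub>R axis ?i 1"
    then have "T y + g (T y) *\<^sub>R axis i 1 = T z + g (T z) *\<^sub>R axis i 1" using Tsh by metis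
    then have "T y = T z" using yz inj by (auto dest: inj_onD)
    then show "y = z" by (metis T(1))
  qed
  have hT: "(\<lambda>y. h (T y)) integrable_on ?S" using int1 h(1) by blast
  note W = integral_shear_le_wellorder[where g="\<lambda>y. g (T y)" and Dg="\<lambda>y v. Dg (T y) (T v)" and i="?i"
      and h="\<lambda>y. h (T y)" and S="?S", OF meas der inj' _ _ hT, unfolded Tsh Tax]
  have "(\<lambda>y. ?F (T y)) integrable_on ?S" "integral ?S (\<lambda>y. ?F (T y)) \<le> integral ?S (\<lambda>y. h (T y))"
    by (rule W; use img pos h in \<open>simp add: Tsh\<close>)+
  moreover have "(?F has_integral integral ?S (\<lambda>y. ?F (T y))) S"
    by (rule int2[of ?F]) (rule integrable_integral, fact)
  ultimately show ?thesis
    using eq[OF h(1)] by (simp add: has_integral_iff)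
qed

section \<open>Inner variations of weak solutions\<close>

lemma linear_axis_expansion:
  fixes L :: "real^'m::finite \<Rightarrow> 'b::real_vector"
  assumes "linear L"
  shows "L v = (\<Sum>j\<in>UNIV. v $ j *\<^sub>R L (axis j 1))"
proof -
  have "L v = L (\<Sum>j\<in>UNIV. v $ j *\<^sub>R axis j 1)"
    by (simp add: basis_expansion flip: scalar_mult_eq_scaleR)
  then show ?thesis using assms by (simp add: linear_sum linear_cmul)
qed

lemma bounded_partials_imp_Lipschitz:
  fixes F :: "real^'m::finite \<Rightarrow> 'b::real_normed_vector"
  assumes C: "convex C" and F: "\<And>x. x \<in> C \<Longrightarrow> (F has_derivative DF x) (at x within C)"
    and b: "\<And>x j. x \<in> C \<Longrightarrow> norm (DF x (axis j 1)) \<le> b j"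
    and xy: "x \<in> C" "y \<in> C"
  shows "norm (F x - F y) \<le> (\<Sum>j\<in>UNIV. b j) * norm (x - y)"
proof (rule differentiable_bound[OF C F _ xy])
  fix z assume z: "z \<in> C"
  show "onorm (DF z) \<le> (\<Sum>j\<in>UNIV. b j)"
  proof (rule onorm_le)
    fix v
    have "norm (DF z v) = norm (\<Sum>j\<in>UNIV. v $ j *\<^sub>R DF z (axis j 1))"
      by (subst linear_axis_expansion[OF has_derivative_linear[OF F[OF z]]]) simp
    also have "\<dots> \<le> (\<Sum>j\<in>UNIV. norm v * b j)"
      by (rule sum_norm_le) (auto intro!: mult_mono b z simp: component_le_norm_cart)
    finally show "norm (DF z v) \<le> (\<Sum>j\<in>UNIV. b j) * norm v"
      by (simp add: sum_distrib_left[symmetric] mult.commute)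
  qed
qed

lemma continuous_on_compact_norm_bound:
  fixes f :: "'a::topological_space \<Rightarrow> 'b::real_normed_vector"
  assumes "compact C" "continuous_on C f"
  obtains B where "B \<ge> 0" "\<And>x. x \<in> C \<Longrightarrow> norm (f x) \<le> B"
proof -
  have "bounded (f ` C)" using assms by (simp add: compact_continuous_image compact_imp_bounded)
  then obtain B where "\<And>x. x \<in> C \<Longrightarrow> norm (f x) \<le> B" by (auto simp: bounded_iff)
  then show ?thesis by (intro that[of "max 0 B"]) (auto simp: le_max_iff_disj)
qed

text \<open>Compactness bounds the partial derivatives and convexity integrates the bound along
  segments. The estimate holds up to the boundary and later dominates the difference quotients of
  the weights and of \<open>u\<close>.\<close>

lemma continuous_partials_imp_Lipschitz:
  fixes F :: "real^'m::finite \<Rightarrow> 'b::real_normed_vector"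
  assumes C: "compact C" "convex C" "C \<subseteq> S"
    and F: "\<And>x. x \<in> S \<Longrightarrow> (F has_derivative DF x) (at x within S)"
    and DF: "\<And>j. continuous_on S (\<lambda>x. DF x (axis j 1))"
  obtains M where "M \<ge> 0" "\<And>x y. x \<in> C \<Longrightarrow> y \<in> C \<Longrightarrow> norm (F x - F y) \<le> M * norm (x - y)"
proof -
  have "\<exists>b\<ge>0. \<forall>x\<in>C. norm (DF x (axis j 1)) \<le> b" for j
    using continuous_on_compact_norm_bound[OF C(1) continuous_on_subset[OF DF C(3)]] by metis
  then obtain b where b: "\<And>j. b j \<ge> 0" "\<And>j x. x \<in> C \<Longrightarrow> norm (DF x (axis j 1)) \<le> b j" by metis
  show ?thesis
  proof (rule that)
    show "(\<Sum>j\<in>UNIV. b j) \<ge> 0" by (simp add: sum_nonneg b)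
    fix x y assume "x \<in> C" "y \<in> C"
    then show "norm (F x - F y) \<le> (\<Sum>j\<in>UNIV. b j) * norm (x - y)"
      using C F b(2) by (intro bounded_partials_imp_Lipschitz[where DF=DF]) (auto intro: has_derivative_subset)
  qed
qed

section \<open>Half spaces and half boxes\<close>

lemma half_space_simps [simp]:
  "x \<in> half_space k \<longleftrightarrow> x $ k \<ge> 0" "x \<in> half_space_interior k \<longleftrightarrow> x $ k > 0"
  "x \<in> half_space_boundary k \<longleftrightarrow> x $ k = 0"
  by (auto simp: half_space_def half_space_interior_def half_space_boundary_def)

lemma closed_half_space: "closed (half_space k)"
  unfolding half_space_def by (simp add: closed_halfspace_component_ge_cart)

lemma open_half_space_interior: "open (half_space_interior k)"
  unfolding half_space_interior_def by (simp add: open_halfspace_component_gt_cart)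

lemma at_within_half_space: "x $ k > 0 \<Longrightarrow> at x within half_space k = at x"
  by (rule at_within_open_subset[OF _ open_half_space_interior]) auto

text \<open>A box with one face on the boundary is used instead of a half ball: it is a
  \<open>cbox\<close>, on which continuous functions are integrable, and it is compact and convex,
  as the Lipschitz bounds require.\<close>

definition half_box :: "'m::finite \<Rightarrow> real \<Rightarrow> (real^'m) set" where
  "half_box k R = cbox (\<chi> j. if j = k then 0 else - R) (\<chi> j. R)"

lemma mem_half_box: "R \<ge> 0 \<Longrightarrow> x \<in> half_box k R \<longleftrightarrow> x $ k \<ge> 0 \<and> (\<forall>j. \<bar>x $ j\<bar> \<le> R)"
proof -
  assume "R \<ge> 0"
  then have "(if j = k then 0 else - R) \<le> x $ j \<and> x $ j \<le> R \<longleftrightarrow> (j = k \<longrightarrow> 0 \<le> x $ k) \<and> \<bar>x $ j\<bar> \<le> R" for j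
    by (cases "j = k") auto
  then show ?thesis
    unfolding half_box_def mem_box_cart vec_lambda_beta by (simp only:) blast
qed

lemma half_box_subset: "half_box k R \<subseteq> half_space k"
  unfolding half_box_def by (auto simp: mem_box_cart dest!: spec[of _ k])

lemma norm_le_imp_half_box: "x $ k \<ge> 0 \<Longrightarrow> norm x \<le> R \<Longrightarrow> x \<in> half_box k R"
  using order_trans[OF component_le_norm_cart] order_trans[OF norm_ge_zero[of x]]
  by (subst mem_half_box) blast+

text \<open>The Euclidean form of the problem. The gradient part and the potential scale differently
  under the conformal change, so each carries its own weight, \<open>w1\<close> and
  \<open>w0\<close>; \<kappa> stands for \<epsilon>^(-n). Nothing is assumed here about the boundary
  values or the radial growth of the weights.\<close>

locale weighted_weak_solution =
  fixes k :: "'m::finite" and p \<kappa> :: real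
    and w1 w0 :: "real^'m \<Rightarrow> real" and Dw1 Dw0 :: "real^'m \<Rightarrow> real^'m \<Rightarrow> real"
    and u :: "real^'m \<Rightarrow> real^'n::finite" and Du :: "real^'m \<Rightarrow> real^'m \<Rightarrow> real^'n"
  assumes p2: "2 \<le> p" and pm: "2 * p < real CARD('m)" and kappa: "\<kappa> \<ge> 0"
    and w1_nonneg: "\<And>x. x \<in> half_space k \<Longrightarrow> w1 x \<ge> 0"
    and w0_nonneg: "\<And>x. x \<in> half_space k \<Longrightarrow> w0 x \<ge> 0"
    and w1_deriv: "\<And>x. x \<in> half_space k \<Longrightarrow> (w1 has_derivative Dw1 x) (at x within half_space k)"
    and w0_deriv: "\<And>x. x \<in> half_space k \<Longrightarrow> (w0 has_derivative Dw0 x) (at x within half_space k)"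
    and w1_C1: "\<And>j. continuous_on (half_space k) (\<lambda>x. Dw1 x (axis j 1))"
    and w0_C1: "\<And>j. continuous_on (half_space k) (\<lambda>x. Dw0 x (axis j 1))"
    and u_deriv: "\<And>x. x \<in> half_space k \<Longrightarrow> (u has_derivative Du x) (at x within half_space k)"
    and u_C1: "\<And>j. continuous_on (half_space k) (\<lambda>x. Du x (axis j 1))"
    and weak: "\<And>\<psi> D\<psi>. \<lbrakk>\<And>x. (\<psi> has_derivative D\<psi> x) (at x);
        \<And>j. continuous_on UNIV (\<lambda>x. D\<psi> x (axis j 1));
        compact (closure {x. \<psi> x \<noteq> 0}); closure {x. \<psi> x \<noteq> 0} \<subseteq> half_space_interior k\<rbrakk>
      \<Longrightarrow> ((\<lambda>x. w1 x * (\<Sum>j\<in>UNIV. sigma_frame p (\<lambda>j. Du x (axis j 1)) j \<bullet> D\<psi> x (axis j 1))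
             - w0 x * ((1 - (norm (u x))^2) * \<kappa> * (u x \<bullet> \<psi> x))) has_integral 0) (half_space k)"
    and finite_energy:
      "(\<lambda>x. w1 x * frame_density p (\<lambda>j. Du x (axis j 1)) + w0 x * potential \<kappa> (u x)) integrable_on half_space k"
begin

definition grad :: "real^'m \<Rightarrow> 'm \<Rightarrow> real^'n" where
  "grad x j = Du x (axis j 1)"

definition energy :: "real^'m \<Rightarrow> real" where
  "energy x = w1 x * frame_density p (grad x) + w0 x * potential \<kappa> (u x)"

lemma grad_eq: "grad x = (\<lambda>j. Du x (axis j 1))"
  by (auto simp: grad_def)

lemma pm': "2 * p \<le> real CARD('m)"
  using pm by simp

lemma continuous_on_grad: "continuous_on (half_space k) (\<lambda>x. grad x j)"
  unfolding grad_def by (rule u_C1)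

lemma continuous_on_u: "continuous_on (half_space k) u"
  by (rule has_derivative_continuous_on) (rule u_deriv)

lemma continuous_on_w1: "continuous_on (half_space k) w1"
  by (rule has_derivative_continuous_on) (rule w1_deriv)

lemma continuous_on_w0: "continuous_on (half_space k) w0"
  by (rule has_derivative_continuous_on) (rule w0_deriv)

lemma continuous_on_density: "continuous_on (half_space k) (\<lambda>x. frame_density p (grad x))"
  by (rule continuous_on_frame_density[OF p2 continuous_on_grad])

lemma continuous_on_sigma: "continuous_on (half_space k) (\<lambda>x. sigma_frame p (grad x) j)"
  by (rule continuous_on_sigma_frame[OF p2 continuous_on_grad])

lemma continuous_on_pot: "continuous_on (half_space k) (\<lambda>x. potential \<kappa> (u x))"
  by (rule continuous_on_potential[OF continuous_on_u])

lemma continuous_on_energy: "continuous_on (half_space k) energy"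
  unfolding energy_def
  by (intro continuous_on_add continuous_on_mult continuous_on_w1 continuous_on_w0 continuous_on_density continuous_on_pot)

lemma density_nonneg: "frame_density p (grad x) \<ge> 0"
  by (rule frame_density_nonneg[OF p2 pm'])

lemma energy_nonneg: "x \<in> half_space k \<Longrightarrow> energy x \<ge> 0"
  unfolding energy_def
  by (intro add_nonneg_nonneg mult_nonneg_nonneg w1_nonneg w0_nonneg density_nonneg potential_nonneg kappa)

lemma energy_integrable: "energy integrable_on half_space k"
  using finite_energy unfolding energy_def grad_eq .

lemma linear_Du: "x \<in> half_space k \<Longrightarrow> linear (Du x)"
  using u_deriv has_derivative_linear by blast

end

text \<open>Since \<open>g\<close> vanishes in a layer of width \<delta> along the boundary and
  outside a ball, moving points by t g along one axis changes \<open>u\<close> only on a compact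
  part of the open half space, where the weak equation may be tested.\<close>

locale shear_variation = weighted_weak_solution k p \<kappa> w1 w0 Dw1 Dw0 u Du
  for k :: "'m::finite" and p \<kappa> :: real
    and w1 w0 :: "real^'m \<Rightarrow> real" and Dw1 Dw0 :: "real^'m \<Rightarrow> real^'m \<Rightarrow> real"
    and u :: "real^'m \<Rightarrow> real^'n::finite" and Du :: "real^'m \<Rightarrow> real^'m \<Rightarrow> real^'n" +
  fixes i :: 'm and g :: "real^'m \<Rightarrow> real" and Dg :: "real^'m \<Rightarrow> real^'m \<Rightarrow> real" and \<delta> R :: real
  assumes g_deriv: "\<And>x. (g has_derivative Dg x) (at x)"
    and g_C1: "\<And>j. continuous_on UNIV (\<lambda>x. Dg x (axis j 1))"
    and delta: "\<delta> > 0" and R_nonneg: "R \<ge> 0"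
    and support: "\<And>x. g x \<noteq> 0 \<Longrightarrow> x $ k \<ge> \<delta> \<and> norm x \<le> R"
begin

lemma g_zero: "x $ k < \<delta> \<or> norm x > R \<Longrightarrow> g x = 0"
  using support[of x] by force

lemma Dg_zero:
  assumes "x $ k < \<delta> \<or> norm x > R"
  shows "Dg x v = 0"
proof -
  let ?S = "{x. x $ k < \<delta>} \<union> {x. norm x > R}"
  have "open ?S"
    by (intro open_Un open_halfspace_component_lt_cart open_Collect_less continuous_intros)
  moreover have "((\<lambda>x. 0 :: real) has_derivative (\<lambda>_. 0)) (at x)" by simp
  ultimately have "(g has_derivative (\<lambda>_. 0)) (at x)"
    using has_derivative_transform_within_open[of "\<lambda>_. 0" "\<lambda>_. 0" x UNIV ?S g] assms g_zero by auto
  then have "Dg x = (\<lambda>_. 0)" using g_deriv has_derivative_unique by blast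
  then show ?thesis by simp
qed

lemma continuous_on_g: "continuous_on S g"
  using g_deriv by (meson continuous_at_imp_continuous_on has_derivative_continuous)

lemma g_bounded: obtains G where "G \<ge> 0" "\<And>x. \<bar>g x\<bar> \<le> G"
proof -
  obtain G where G: "G \<ge> 0" "\<And>x. x \<in> cball 0 R \<Longrightarrow> norm (g x) \<le> G"
    using continuous_on_compact_norm_bound[OF compact_cball continuous_on_g] by blast
  then have "\<bar>g x\<bar> \<le> G" for x
    using g_zero[of x] by (cases "norm x \<le> R") auto
  then show ?thesis using G that by blast
qed

lemma Dg_bounded: obtains b where "\<And>j. b j \<ge> 0" "\<And>x j. \<bar>Dg x (axis j 1)\<bar> \<le> b j"
proof -
  have "\<exists>b\<ge>0. \<forall>x. \<bar>Dg x (axis j 1)\<bar> \<le> b" for j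
  proof -
    obtain G where G: "G \<ge> 0" "\<And>x. x \<in> cball 0 R \<Longrightarrow> norm (Dg x (axis j 1)) \<le> G"
      using continuous_on_compact_norm_bound[OF compact_cball continuous_on_subset[OF g_C1]] by blast
    then have "\<bar>Dg x (axis j 1)\<bar> \<le> G" for x
      using Dg_zero[of x] by (cases "norm x \<le> R") auto
    then show ?thesis using G by blast
  qed
  then show ?thesis using that by metis
qed

definition shear :: "real \<Rightarrow> real^'m \<Rightarrow> real^'m" where
  "shear t x = x + (t * g x) *\<^sub>R axis i 1"

text \<open>The partial derivatives of \<open>u\<close> composed with the shear, as given by the
  chain rule.\<close>

definition shear_grad :: "real \<Rightarrow> real^'m \<Rightarrow> 'm \<Rightarrow> real^'n" where
  "shear_grad t x j = grad (shear t x) j + (t * Dg x (axis j 1)) *\<^sub>R grad (shear t x) i"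

definition remainder :: "real \<Rightarrow> real^'m \<Rightarrow> real" where
  "remainder t x = w1 x * (\<Sum>j\<in>UNIV. Dg x (axis j 1) * (sigma_frame p (shear_grad t x) j \<bullet> grad (shear t x) i))
    - w1 (shear t x) * Dg x (axis i 1) * frame_density p (grad (shear t x))
    - w0 (shear t x) * Dg x (axis i 1) * potential \<kappa> (u (shear t x))"

text \<open>An upper bound, divided by t, for the discrepancy between testing the equation and
  transporting the energy: the weights sit at x in the equation but at the sheared point in the
  transported energy. The terms free of difference quotients are kept in \<open>remainder\<close>,
  which is jointly continuous in t and x down to t = 0.\<close>

definition quotient :: "real \<Rightarrow> real^'m \<Rightarrow> real" where
  "quotient t x = (w1 x - w1 (shear t x)) / t * frame_density p (grad (shear t x))
    + (w0 x - w0 (shear t x)) / t * potential \<kappa> (u (shear t x))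
    + w0 x * (\<kappa> / 2 * (norm (u (shear t x) - u x))^2) / t + remainder t x"

text \<open>The pointwise limit of \<open>quotient\<close> as t tends to 0. It is the inner
  variation integrand along g e_i: the stress contracted with the gradient of g, minus each density
  times the i-th derivative of g times its weight.\<close>

definition first_variation :: "real^'m \<Rightarrow> real" where
  "first_variation x = w1 x * (\<Sum>j\<in>UNIV. Dg x (axis j 1) * (sigma_frame p (grad x) j \<bullet> grad x i))
    - (Dw1 x (axis i 1) * g x + w1 x * Dg x (axis i 1)) * frame_density p (grad x)
    - (Dw0 x (axis i 1) * g x + w0 x * Dg x (axis i 1)) * potential \<kappa> (u x)"

lemma shear_fixed: "x $ k < \<delta> \<or> norm x > R \<Longrightarrow> shear t x = x"
  by (simp add: shear_def g_zero)

lemma shear_0: "shear 0 x = x"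
  by (simp add: shear_def)

lemma shear_grad_fixed: "x $ k < \<delta> \<or> norm x > R \<Longrightarrow> shear_grad t x = grad x"
  by (auto simp: shear_grad_def shear_fixed Dg_zero)

lemma shear_grad_0: "shear_grad 0 x = grad x"
  by (auto simp: shear_grad_def shear_0)

definition small :: "real \<Rightarrow> bool" where
  "small t \<longleftrightarrow> t \<ge> 0 \<and> (\<forall>x. t * \<bar>g x\<bar> \<le> \<delta> / 2 \<and> t * \<bar>g x\<bar> \<le> 1)
     \<and> (\<forall>x y. t * \<bar>g x - g y\<bar> \<le> 1/2 * norm (x - y)) \<and> (\<forall>x. t * \<bar>Dg x (axis i 1)\<bar> \<le> 1/2)"

lemma ex_small: obtains t0 where "t0 > 0" "\<And>t. 0 \<le> t \<Longrightarrow> t \<le> t0 \<Longrightarrow> small t"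
proof -
  obtain G where G: "G \<ge> 0" "\<And>x. \<bar>g x\<bar> \<le> G" using g_bounded by blast
  obtain b where b: "\<And>j. b j \<ge> 0" "\<And>x j. \<bar>Dg x (axis j 1)\<bar> \<le> b j" using Dg_bounded by blast
  define L where "L = (\<Sum>j\<in>UNIV. b j)"
  have L: "L \<ge> 0" "b i \<le> L" unfolding L_def using b(1) by (auto intro: sum_nonneg member_le_sum)
  have lip: "\<bar>g x - g y\<bar> \<le> L * norm (x - y)" for x y
    unfolding L_def real_norm_def[symmetric]
    by (rule bounded_partials_imp_Lipschitz[where C=UNIV and DF=Dg]) (use g_deriv b in auto)
  \<comment> \<open>The added 1 avoids division by zero. The first entry serves the two displacement
    bounds, the second the Lipschitz and the Jacobian bound.\<close>
  define t0 where "t0 = min (min (\<delta> / 2) 1 / (G + 1)) (1 / (2 * (L + 1)))"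
  show ?thesis
  proof
    show "t0 > 0" unfolding t0_def using delta G L by simp
    fix t assume t: "0 \<le> t" "t \<le> t0"
    have tG: "t * (G + 1) \<le> min (\<delta> / 2) 1" 
      using t G unfolding t0_def by (simp add: pos_le_divide_eq)
    have tL: "t * (L + 1) \<le> 1/2"
      using t L unfolding t0_def by (simp add: pos_le_divide_eq field_simps)
    have 1: "t * \<bar>g x\<bar> \<le> min (\<delta> / 2) 1" for x
      using tG mult_left_mono[of "\<bar>g x\<bar>" "G+1" t] G(2)[of x] t by linarith
    have 2: "t * \<bar>Dg x (axis i 1)\<bar> \<le> 1/2" for x
      using tL mult_left_mono[of "\<bar>Dg x (axis i 1)\<bar>" "L+1" t] b(2)[of x i] L t by linarith
    have 3: "t * \<bar>g x - g y\<bar> \<le> 1/2 * norm (x - y)" for x y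
    proof -
      have "t * \<bar>g x - g y\<bar> \<le> t * ((L + 1) * norm (x - y))"
        using t lip[of x y] by (intro mult_left_mono) (auto simp: distrib_right intro: add_increasing2)
      also have "\<dots> = (t * (L + 1)) * norm (x - y)" by simp
      also have "\<dots> \<le> 1/2 * norm (x - y)" by (rule mult_right_mono[OF tL]) simp
      finally show ?thesis .
    qed
    show "small t" unfolding small_def using t 1 2 3 by auto
  qed
qed

lemma shear_component: "shear t x $ j = x $ j + (if j = i then t * g x else 0)"
  by (simp add: shear_def axis_def)

lemma shear_pos: 
  assumes "small t" "x $ k > 0" shows "shear t x $ k > 0"
proof (cases "x $ k < \<delta>")
  case True then show ?thesis using assms by (simp add: shear_fixed)
next
  case False
  have "\<bar>t * g x\<bar> \<le> \<delta> / 2" using assms by (simp add: small_def abs_mult)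
  then have "t * g x \<ge> - (\<delta> / 2)" by linarith
  then show ?thesis using False delta by (auto simp: shear_component)
qed

lemma shear_half_space: 
  assumes "small t" "x \<in> half_space k" shows "shear t x \<in> half_space k"
  using shear_pos[OF assms(1), of x] assms(2) shear_fixed[of x t] delta by (cases "x $ k = 0") auto

lemma shear_half_box:
  assumes t: "small t" and x: "x \<in> half_box k (R + 1)"
  shows "shear t x \<in> half_box k (R + 1)"
proof (cases "norm x > R")
  case False
  have "norm (shear t x) \<le> norm x + \<bar>t * g x\<bar>"
    unfolding shear_def by (rule order_trans[OF norm_triangle_ineq]) (simp add: norm_axis_1)
  also have "\<bar>t * g x\<bar> \<le> 1" using t by (simp add: small_def abs_mult)
  finally have "norm (shear t x) \<le> R + 1" using False by simp
  moreover have "shear t x $ k \<ge> 0" using shear_half_space[OF t] x half_box_subset by force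
  ultimately show ?thesis by (intro norm_le_imp_half_box)
qed (use x in \<open>simp add: shear_fixed\<close>)

lemma inj_shear:
  assumes "small t" shows "inj_on (shear t) S"
proof (rule inj_onI)
  fix x y assume "shear t x = shear t y"
  then have "x - y = (t * (g y - g x)) *\<^sub>R axis i 1"
    by (simp add: shear_def algebra_simps)
  then have "norm (x - y) = t * \<bar>g y - g x\<bar>"
    using assms by (simp add: norm_axis_1 abs_mult small_def)
  also have "\<dots> \<le> 1/2 * norm (y - x)" using assms by (auto simp: small_def)
  finally show "x = y" by (simp add: norm_minus_commute)
qed

lemma shear_deriv: "(shear t has_derivative (\<lambda>v. v + (t * Dg x v) *\<^sub>R axis i 1)) (at x within S)"
  unfolding shear_def by (auto intro!: derivative_eq_intros has_derivative_at_withinI[OF g_deriv])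

text \<open>The factor is the Jacobian of the shear, so the integral on the left is the energy over
  the image of the half space, which lies in the half space again.\<close>

lemma energy_transport:
  assumes t: "small t"
  shows "(\<lambda>x. (1 + t * Dg x (axis i 1)) * energy (shear t x)) integrable_on half_space k \<and>
    integral (half_space k) (\<lambda>x. (1 + t * Dg x (axis i 1)) * energy (shear t x)) \<le> integral (half_space k) energy"
proof -
  have shear: "x + (t * g x) *\<^sub>R axis i 1 = shear t x" for x by (simp add: shear_def)
  show ?thesis
  proof (rule integral_shear_le[where g="\<lambda>x. t * g x" and Dg="\<lambda>x v. t * Dg x v" and i=i and h=energy and S="half_space k",
        unfolded shear])
    show "((\<lambda>x. t * g x) has_derivative (\<lambda>v. t * Dg x v)) (at x within half_space k)" for x
      by (auto intro!: derivative_eq_intros has_derivative_at_withinI[OF g_deriv])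
    show "0 \<le> 1 + t * Dg x (axis i 1)" for x
    proof -
      have "\<bar>t * Dg x (axis i 1)\<bar> \<le> 1/2" using t by (simp add: small_def abs_mult)
      then show ?thesis by (simp add: abs_le_iff)
    qed
  qed (use t in \<open>auto intro: closed_half_space inj_shear energy_integrable energy_nonneg shear_half_space simp del: half_space_simps\<close>)
qed

lemma continuous_on_shear_pair: "continuous_on Z (\<lambda>z. shear (fst z) (snd z))"
  unfolding shear_def
  by (intro continuous_intros continuous_on_compose2[OF continuous_on_g[of UNIV]]) auto

text \<open>Continuity in both variables together yields the uniform bound on a compact product and
  the limit at t = 0 in one stroke.\<close>

lemma continuous_on_remainder:
  assumes Z: "\<And>z. z \<in> Z \<Longrightarrow> small (fst z) \<and> snd z \<in> half_space k"
  shows "continuous_on Z (\<lambda>z. remainder (fst z) (snd z))"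
proof -
  have PZ: "(\<lambda>z. shear (fst z) (snd z)) ` Z \<subseteq> half_space k"
    using Z shear_half_space by blast
  have sZ: "snd ` Z \<subseteq> half_space k" using Z by blast
  note cP = continuous_on_compose2[OF _ continuous_on_shear_pair PZ]
  note cS = continuous_on_compose2[OF _ continuous_on_snd[OF continuous_on_id] sZ]
  have cD: "continuous_on Z (\<lambda>z. Dg (snd z) (axis j 1))" for j
    by (rule continuous_on_compose2[OF g_C1 continuous_on_snd[OF continuous_on_id]]) auto
  have cA: "continuous_on Z (\<lambda>z. shear_grad (fst z) (snd z) j)" for j
    unfolding shear_grad_def
    by (intro continuous_on_add continuous_on_scaleR continuous_on_mult continuous_on_fst continuous_on_id
        cP[OF continuous_on_grad] cD)
  show ?thesis
    unfolding remainder_def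
    by (intro continuous_on_diff continuous_on_mult continuous_on_sum continuous_on_inner cD
        continuous_on_sigma_frame[OF p2 cA] cP[OF continuous_on_grad] cP[OF continuous_on_w1]
        cP[OF continuous_on_w0] cS[OF continuous_on_w1] cP[OF continuous_on_density] cP[OF continuous_on_pot])
qed

lemma shear_maps: "small t \<Longrightarrow> shear t ` half_space k \<subseteq> half_space k"
  using shear_half_space by blast

lemma continuous_on_shear: "continuous_on S (shear t)"
  unfolding shear_def by (intro continuous_intros continuous_on_g)

lemmas continuous_on_compose_shear = continuous_on_compose2[OF _ continuous_on_shear shear_maps]

lemma continuous_on_quotient:
  assumes t: "small t"
  shows "continuous_on (half_space k) (quotient t)"
proof -
  have "Pair t ` half_space k \<subseteq> {t} \<times> half_space k" by blast
  then have remainder: "continuous_on (half_space k) (\<lambda>x. remainder t x)"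
    using continuous_on_compose2[OF continuous_on_remainder[of "{t} \<times> half_space k"]
        continuous_on_Pair[OF continuous_on_const continuous_on_id, of "half_space k" t]] t
    by auto
  note c = continuous_on_compose_shear[OF _ t]
  show ?thesis
    unfolding quotient_def divide_inverse
    by (intro continuous_on_add continuous_on_mult continuous_on_diff continuous_on_const continuous_on_power
        continuous_on_norm remainder c[OF continuous_on_w1] c[OF continuous_on_w0] c[OF continuous_on_u]
        c[OF continuous_on_density] c[OF continuous_on_pot] continuous_on_w1 continuous_on_w0 continuous_on_u)
qed

lemma outside_half_box: "x \<notin> half_box k (R + 1) \<Longrightarrow> x $ k < \<delta> \<or> norm x > R"
  using norm_le_imp_half_box[of x k "R + 1"] delta by fastforce

lemma quotient_zero: "x \<notin> half_box k (R + 1) \<Longrightarrow> quotient t x = 0"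
  using outside_half_box[of x] by (auto simp: quotient_def remainder_def shear_fixed Dg_zero)

lemma first_variation_zero: "x \<notin> half_box k (R + 1) \<Longrightarrow> first_variation x = 0"
  using outside_half_box[of x] by (auto simp: first_variation_def g_zero Dg_zero)

lemma quotient_integrable_half_box: "small t \<Longrightarrow> quotient t integrable_on half_box k (R + 1)"
  using continuous_on_subset[OF continuous_on_quotient half_box_subset]
  unfolding half_box_def by (rule integrable_continuous)

lemma quotient_integrable:
  assumes "small t"
  shows "quotient t integrable_on half_space k"
    "integral (half_space k) (quotient t) = integral (half_box k (R + 1)) (quotient t)"
proof -
  have "(quotient t has_integral integral (half_box k (R + 1)) (quotient t)) (half_space k)"
    by (rule has_integral_on_superset[OF integrable_integral[OF quotient_integrable_half_box[OF assms]] quotient_zero half_box_subset])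
  then show "quotient t integrable_on half_space k"
    "integral (half_space k) (quotient t) = integral (half_box k (R + 1)) (quotient t)"
    by (auto simp: has_integral_iff)
qed

section \<open>The displacement of \<open>u\<close> as an admissible test map\<close>

definition \<psi> :: "real \<Rightarrow> real^'m \<Rightarrow> real^'n" where
  "\<psi> t x = u (shear t x) - u x"

text \<open>\<open>Du\<close> is controlled only on the closed half space, while a test map must be
  differentiable everywhere. The value 0 is correct at and beyond the boundary, since the shear is
  the identity below height \<delta>.\<close>

definition D\<psi> :: "real \<Rightarrow> real^'m \<Rightarrow> real^'m \<Rightarrow> real^'n" where
  "D\<psi> t x v = (if x $ k > 0 then Du (shear t x) (v + (t * Dg x v) *\<^sub>R axis i 1) - Du x v else 0)"

lemma D\<psi>_axis:
  assumes t: "small t" and x: "x \<in> half_space k"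
  shows "D\<psi> t x (axis j 1) = shear_grad t x j - grad x j"
proof (cases "x $ k > 0")
  case True
  have "linear (Du (shear t x))" using linear_Du shear_half_space[OF t x] by blast
  then show ?thesis using True
    by (simp add: D\<psi>_def shear_grad_def grad_def linear_add linear_cmul)
next
  case False
  then show ?thesis using shear_grad_fixed[of x t] delta x by (simp add: D\<psi>_def)
qed

lemma \<psi>_support: "{x. \<psi> t x \<noteq> 0} \<subseteq> {x. x $ k \<ge> \<delta>} \<inter> cball 0 R"
proof
  fix x assume "x \<in> {x. \<psi> t x \<noteq> 0}"
  then have "shear t x \<noteq> x" by (auto simp: \<psi>_def)
  then show "x \<in> {x. x $ k \<ge> \<delta>} \<inter> cball 0 R" using shear_fixed[of x t] by force
qed

lemma test_map_deriv:
  assumes t: "small t"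
  shows "(\<psi> t has_derivative D\<psi> t x) (at x)"
proof (cases "x $ k > 0")
  case True
  have "(u has_derivative Du (shear t x)) (at (shear t x))"
    using u_deriv[of "shear t x"] shear_pos[OF t True] at_within_half_space[of "shear t x"] by simp
  from has_derivative_compose[OF shear_deriv[of t x UNIV] this]
  have "((\<lambda>x. u (shear t x)) has_derivative (\<lambda>v. Du (shear t x) (v + (t * Dg x v) *\<^sub>R axis i 1))) (at x)" .
  moreover have "(u has_derivative Du x) (at x)"
    using u_deriv[of x] True at_within_half_space[of x] by simp
  ultimately have "((\<lambda>x. u (shear t x) - u x) has_derivative
      (\<lambda>v. Du (shear t x) (v + (t * Dg x v) *\<^sub>R axis i 1) - Du x v)) (at x)"
    by (rule has_derivative_diff)
  then show ?thesis using True by (simp add: \<psi>_def[abs_def] D\<psi>_def[abs_def])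
next
  case False
  have "open {x::real^'m. x $ k < \<delta>}" by (rule open_halfspace_component_lt_cart)
  then have "(\<psi> t has_derivative (\<lambda>_. 0)) (at x)"
    using has_derivative_transform_within_open[of "\<lambda>_. 0" "\<lambda>_. 0" x UNIV "{x. x $ k < \<delta>}" "\<psi> t"]
      False delta shear_fixed by (auto simp: \<psi>_def)
  then show ?thesis using False by (simp add: D\<psi>_def[abs_def])
qed

lemma continuous_on_shear_grad: "small t \<Longrightarrow> continuous_on (half_space k) (\<lambda>x. shear_grad t x j)"
  unfolding shear_grad_def
  by (intro continuous_on_add continuous_on_scaleR continuous_on_mult continuous_on_const
      continuous_on_compose_shear[OF continuous_on_grad] continuous_on_subset[OF g_C1]) auto

text \<open>On the open half space the partial derivatives are given by a continuous formula, and
  below height \<delta> they vanish. These two open sets cover the space.\<close>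

lemma test_map_C1:
  assumes t: "small t"
  shows "continuous_on UNIV (\<lambda>x. D\<psi> t x (axis j 1))"
proof -
  have "continuous_on (half_space k) (\<lambda>x. shear_grad t x j - grad x j)"
    by (intro continuous_on_diff continuous_on_shear_grad[OF t] continuous_on_grad)
  then have "continuous_on (half_space k) (\<lambda>x. D\<psi> t x (axis j 1))"
    by (rule continuous_on_eq) (simp only: D\<psi>_axis[OF t])
  then have 1: "continuous_on {x. x $ k > 0} (\<lambda>x. D\<psi> t x (axis j 1))"
    by (rule continuous_on_subset) auto
  have "D\<psi> t x (axis j 1) = 0" if "x $ k < \<delta>" for x
  proof (cases "x $ k > 0")
    case True
    then have "x \<in> half_space k" by simp
    then show ?thesis using D\<psi>_axis[OF t, of x] shear_grad_fixed[of x t] that by simp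
  qed (simp add: D\<psi>_def)
  then have 2: "continuous_on {x. x $ k < \<delta>} (\<lambda>x. D\<psi> t x (axis j 1))"
    by (intro continuous_on_eq[OF continuous_on_const[of _ 0]]) auto
  have "continuous_on ({x. x $ k > 0} \<union> {x. x $ k < \<delta>}) (\<lambda>x. D\<psi> t x (axis j 1))"
    by (rule continuous_on_open_Un[OF open_halfspace_component_gt_cart open_halfspace_component_lt_cart 1 2])
  moreover have "{x::real^'m. x $ k > 0} \<union> {x. x $ k < \<delta>} = UNIV" using delta by auto
  ultimately show ?thesis by simp
qed

lemma weak_form_test_map:
  assumes t: "small t"
  shows "((\<lambda>x. w1 x * (\<Sum>j\<in>UNIV. sigma_frame p (grad x) j \<bullet> (shear_grad t x j - grad x j))
     - w0 x * ((1 - (norm (u x))^2) * \<kappa> * (u x \<bullet> (u (shear t x) - u x)))) has_integral 0) (half_space k)"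
proof -
  let ?C = "{x. x $ k \<ge> \<delta>} \<inter> cball (0::real^'m) R"
  have C: "closed ?C" by (intro closed_Int closed_halfspace_component_ge_cart closed_cball)
  have sub: "closure {x. \<psi> t x \<noteq> 0} \<subseteq> ?C" by (rule closure_minimal[OF \<psi>_support C])
  moreover have "bounded ?C" by (simp add: bounded_Int)
  ultimately have comp: "compact (closure {x. \<psi> t x \<noteq> 0})"
    using bounded_subset by (auto simp: compact_eq_bounded_closed)
  have "closure {x. \<psi> t x \<noteq> 0} \<subseteq> half_space_interior k"
    using sub delta by force
  from weak[OF test_map_deriv[OF t] test_map_C1[OF t] comp this]
  show ?thesis
    by (rule has_integral_cong[THEN iffD1, rotated]) (simp only: D\<psi>_axis[OF t] grad_eq[symmetric] \<psi>_def)
qed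

text \<open>Both uses of convexity point the same way: at \<open>grad x\<close> to pass from the weak form to the
  energies, and at \<open>shear_grad t x\<close> to linearise the energy of the deformed map.\<close>

lemma weak_form_le:
  assumes t: "small t" "t > 0" and x: "x \<in> half_space k"
  shows "w1 x * (\<Sum>j\<in>UNIV. sigma_frame p (grad x) j \<bullet> (shear_grad t x j - grad x j))
     - w0 x * ((1 - (norm (u x))^2) * \<kappa> * (u x \<bullet> (u (shear t x) - u x)))
     \<le> t * quotient t x + (1 + t * Dg x (axis i 1)) * energy (shear t x) - energy x"
proof -
  define y where "y = shear t x"
  define S where "S = (\<Sum>j\<in>UNIV. Dg x (axis j 1) * (sigma_frame p (shear_grad t x) j \<bullet> grad y i))"
  have c1: "(\<Sum>j\<in>UNIV. sigma_frame p (grad x) j \<bullet> (shear_grad t x j - grad x j))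
      \<le> frame_density p (shear_grad t x) - frame_density p (grad x)"
    using frame_density_convex[OF p2 pm', of "grad x" "shear_grad t x"] by simp
  have "(\<Sum>j\<in>UNIV. sigma_frame p (shear_grad t x) j \<bullet> (grad y j - shear_grad t x j)) = - (t * S)"
    unfolding S_def shear_grad_def[of t x] y_def[symmetric]
    by (simp add: sum_negf sum_distrib_left mult.assoc)
  then have c2: "frame_density p (shear_grad t x) \<le> frame_density p (grad y) + t * S"
    using frame_density_convex[OF p2 pm', of "shear_grad t x" "grad y"] by simp
  have "w1 x * (\<Sum>j\<in>UNIV. sigma_frame p (grad x) j \<bullet> (shear_grad t x j - grad x j))
     \<le> w1 x * (frame_density p (grad y) + t * S - frame_density p (grad x))"
    using c1 c2 w1_nonneg[OF x] by (intro mult_left_mono) auto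
  moreover have "w0 x * (potential \<kappa> (u x) - (1 - (norm (u x))^2) * \<kappa> * (u x \<bullet> (u y - u x)))
      \<le> w0 x * (potential \<kappa> (u y) + \<kappa> / 2 * (norm (u y - u x))^2)"
    using w0_nonneg[OF x] by (intro mult_left_mono potential_semiconvex kappa)
  ultimately have "w1 x * (\<Sum>j\<in>UNIV. sigma_frame p (grad x) j \<bullet> (shear_grad t x j - grad x j))
     - w0 x * ((1 - (norm (u x))^2) * \<kappa> * (u x \<bullet> (u y - u x)))
    \<le> w1 x * (frame_density p (grad y) + t * S - frame_density p (grad x))
      + w0 x * (potential \<kappa> (u y) + \<kappa> / 2 * (norm (u y - u x))^2) - w0 x * potential \<kappa> (u x)"
    by (simp add: right_diff_distrib)
  also have "\<dots> = t * quotient t x + (1 + t * Dg x (axis i 1)) * energy y - energy x"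
  proof -
    have tq: "t * quotient t x = (w1 x - w1 y) * frame_density p (grad y)
       + (w0 x - w0 y) * potential \<kappa> (u y) + w0 x * (\<kappa> / 2 * (norm (u y - u x))^2) + t * remainder t x"
      unfolding quotient_def y_def[symmetric] using t by (simp add: distrib_left)
    have "remainder t x = w1 x * S - w1 y * Dg x (axis i 1) * frame_density p (grad y)
       - w0 y * Dg x (axis i 1) * potential \<kappa> (u y)"
      unfolding remainder_def S_def y_def by simp
    then show ?thesis unfolding tq energy_def by (simp only: ring_distribs) (simp add: algebra_simps)
  qed
  finally show ?thesis unfolding y_def .
qed

text \<open>The weak form integrates to 0 and lies below t \<open>quotient\<close> plus the
  transported energy minus the energy. The last two contribute a nonpositive amount in total, so the
  integral of t \<open>quotient\<close> must make up for it.\<close>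

lemma integral_quotient_nonneg:
  assumes t: "small t" "t > 0"
  shows "integral (half_space k) (quotient t) \<ge> 0"
proof -
  let ?E = "\<lambda>x. (1 + t * Dg x (axis i 1)) * energy (shear t x)"
  have E: "?E integrable_on half_space k" "integral (half_space k) ?E \<le> integral (half_space k) energy"
    using energy_transport[OF t(1)] by auto
  have "((\<lambda>x. t * quotient t x + ?E x - energy x) has_integral
      (t * integral (half_space k) (quotient t) + integral (half_space k) ?E - integral (half_space k) energy)) (half_space k)"
    by (intro has_integral_diff has_integral_add has_integral_mult_right integrable_integral
        quotient_integrable E energy_integrable t)
  from has_integral_le[OF weak_form_test_map[OF t(1)] this weak_form_le[OF t]]
  have "0 \<le> t * integral (half_space k) (quotient t)" using E by simp
  then show ?thesis using t by (simp add: zero_le_mult_iff)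
qed

text \<open>Where g vanishes the quotient is identically 0. Elsewhere the point is interior, so the
  one-sided derivative of the weight on the half space is a full derivative and the chain rule along
  the axis applies.\<close>

lemma weight_quotient_limit:
  fixes w :: "real^'m \<Rightarrow> real"
  assumes w: "(w has_derivative Dw) (at x within half_space k)"
    and x: "x \<in> half_space k" and tn: "tn \<longlonglongrightarrow> 0" "\<And>n::nat. tn n > 0"
  shows "(\<lambda>n. (w x - w (shear (tn n) x)) / tn n) \<longlonglongrightarrow> - (Dw (axis i 1) * g x)"
proof (cases "g x = 0")
  case True
  then show ?thesis by (simp add: shear_def)
next
  case False
  then have "x $ k > 0" using support[of x] delta by linarith
  then have w': "(w has_derivative Dw) (at x)" using w at_within_half_space[of x] by simp
  have lin: "linear Dw" using w' by (rule has_derivative_linear)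
  have "((\<lambda>s. x + (s * g x) *\<^sub>R axis i 1) has_derivative (\<lambda>s. (s * g x) *\<^sub>R axis i 1)) (at 0)"
    by (auto intro!: derivative_eq_intros)
  then have "((\<lambda>s. w (x + (s * g x) *\<^sub>R axis i 1)) has_derivative (\<lambda>s. Dw ((s * g x) *\<^sub>R axis i 1))) (at 0)"
    by (rule has_derivative_compose) (use w' in simp)
  then have "((\<lambda>s. w (shear s x)) has_real_derivative (Dw (axis i 1) * g x)) (at 0)"
    unfolding has_field_derivative_def shear_def using lin
    by (simp add: linear_cmul mult_ac mult_commute_abs)
  then have "((\<lambda>s. (w (shear s x) - w x) / s) \<longlongrightarrow> Dw (axis i 1) * g x) (at 0)"
    by (simp add: DERIV_def shear_0)
  moreover have "filterlim tn (at 0) sequentially"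
    using tn by (auto simp: filterlim_at less_imp_neq[THEN not_sym] intro!: always_eventually)
  ultimately have "(\<lambda>n. (w (shear (tn n) x) - w x) / tn n) \<longlonglongrightarrow> Dw (axis i 1) * g x"
    by (rule filterlim_compose)
  from tendsto_minus[OF this] show ?thesis
    by (simp add: minus_divide_left)
qed

section \<open>Domination and passage to the limit in the deformation parameter\<close>

lemma convex_half_box: "convex (half_box k \<rho>)" and compact_half_box: "compact (half_box k \<rho>)"
  unfolding half_box_def by (rule convex_box, rule compact_cbox)

lemma norm_shear_diff: "t \<ge> 0 \<Longrightarrow> norm (x - shear t x) = t * \<bar>g x\<bar>"
  by (simp add: shear_def norm_axis_1 abs_mult)

lemma quotient_bounded:
  assumes t0: "t0 > 0" "\<And>t. 0 \<le> t \<Longrightarrow> t \<le> t0 \<Longrightarrow> small t"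
  obtains B where "\<And>t x. 0 < t \<Longrightarrow> t \<le> t0 \<Longrightarrow> x \<in> half_box k (R + 1) \<Longrightarrow> norm (quotient t x) \<le> B"
proof -
  let ?Q = "half_box k (R + 1)"
  note Q = compact_half_box[of "R + 1"] convex_half_box[of "R + 1"] half_box_subset[of k "R + 1"]
  obtain G where G: "G \<ge> 0" "\<And>x. \<bar>g x\<bar> \<le> G" using g_bounded by blast
  obtain M1 where M1: "M1 \<ge> 0" "\<And>x y. x \<in> ?Q \<Longrightarrow> y \<in> ?Q \<Longrightarrow> norm (w1 x - w1 y) \<le> M1 * norm (x - y)"
    using continuous_partials_imp_Lipschitz[OF Q w1_deriv w1_C1] by blast
  obtain M0 where M0: "M0 \<ge> 0" "\<And>x y. x \<in> ?Q \<Longrightarrow> y \<in> ?Q \<Longrightarrow> norm (w0 x - w0 y) \<le> M0 * norm (x - y)"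
    using continuous_partials_imp_Lipschitz[OF Q w0_deriv w0_C1] by blast
  obtain Mu where Mu: "Mu \<ge> 0" "\<And>x y. x \<in> ?Q \<Longrightarrow> y \<in> ?Q \<Longrightarrow> norm (u x - u y) \<le> Mu * norm (x - y)"
    using continuous_partials_imp_Lipschitz[OF Q u_deriv u_C1] by blast
  obtain F where F: "F \<ge> 0" "\<And>x. x \<in> ?Q \<Longrightarrow> norm (frame_density p (grad x)) \<le> F"
    using continuous_on_compact_norm_bound[OF Q(1) continuous_on_subset[OF continuous_on_density Q(3)]] by blast
  obtain V where V: "V \<ge> 0" "\<And>x. x \<in> ?Q \<Longrightarrow> norm (potential \<kappa> (u x)) \<le> V"
    using continuous_on_compact_norm_bound[OF Q(1) continuous_on_subset[OF continuous_on_pot Q(3)]] by blast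
  obtain W where W: "W \<ge> 0" "\<And>x. x \<in> ?Q \<Longrightarrow> norm (w0 x) \<le> W"
    using continuous_on_compact_norm_bound[OF Q(1) continuous_on_subset[OF continuous_on_w0 Q(3)]] by blast
  have "continuous_on ({0..t0} \<times> ?Q) (\<lambda>z. remainder (fst z) (snd z))"
    by (rule continuous_on_remainder) (use t0 Q(3) in auto)
  then obtain N where N: "\<And>z. z \<in> {0..t0} \<times> ?Q \<Longrightarrow> norm (remainder (fst z) (snd z)) \<le> N"
    using continuous_on_compact_norm_bound[OF compact_Times[OF compact_Icc Q(1)]] by blast
  show ?thesis
  proof (rule that)
    fix t x assume t: "0 < t" "t \<le> t0" and x: "x \<in> ?Q"
    have sm: "small t" using t0 t by simp
    have y: "shear t x \<in> ?Q" by (rule shear_half_box[OF sm x])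
    have d: "norm (x - shear t x) \<le> t * G" using norm_shear_diff[of t x] t G by (simp add: mult_left_mono)
    have quot: "\<bar>(w x - w (shear t x)) / t\<bar> \<le> M * G"
      if "M \<ge> 0" "norm (w x - w (shear t x)) \<le> M * norm (x - shear t x)" for w :: "real^'m \<Rightarrow> real" and M
    proof -
      have "\<bar>w x - w (shear t x)\<bar> \<le> M * (t * G)"
        using that mult_left_mono[OF d, of M] by simp
      then show ?thesis using t by (simp add: pos_divide_le_eq mult_ac)
    qed
    have a: "\<bar>(w1 x - w1 (shear t x)) / t * frame_density p (grad (shear t x))\<bar> \<le> (M1 * G) * F"
      unfolding abs_mult using quot[OF M1(1) M1(2)[OF x y]] F(2)[OF y] M1 G by (intro mult_mono) auto
    have b: "\<bar>(w0 x - w0 (shear t x)) / t * potential \<kappa> (u (shear t x))\<bar> \<le> (M0 * G) * V"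
      unfolding abs_mult using quot[OF M0(1) M0(2)[OF x y]] V(2)[OF y] M0 G by (intro mult_mono) auto
    \<comment> \<open>The convexity error of the potential is quadratic in the displacement, so a
      factor t survives the division by t.\<close>
    have "norm (u (shear t x) - u x) \<le> Mu * (t * G)"
      using Mu(2)[OF x y] mult_left_mono[OF d Mu(1)] by (simp add: norm_minus_commute)
    then have "(norm (u (shear t x) - u x))^2 \<le> (Mu * (t * G))^2"
      by (intro power_mono) auto
    also have "\<dots> = t * (Mu * G)^2 * t" by (simp add: power2_eq_square)
    also have "\<dots> \<le> t0 * (Mu * G)^2 * t" using t by (intro mult_right_mono) auto
    finally have sq: "(norm (u (shear t x) - u x))^2 / t \<le> t0 * (Mu * G)^2"
      using t by (simp add: pos_divide_le_eq)
    have c: "\<bar>w0 x * (\<kappa> / 2 * (norm (u (shear t x) - u x))^2) / t\<bar> \<le> W * (\<kappa> / 2) * (t0 * (Mu * G)^2)"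
    proof -
      have "\<bar>w0 x * (\<kappa> / 2 * (norm (u (shear t x) - u x))^2) / t\<bar> = (\<bar>w0 x\<bar> * (\<kappa> / 2)) * ((norm (u (shear t x) - u x))^2 / t)"
        using t kappa by (simp add: abs_mult)
      also have "\<dots> \<le> (W * (\<kappa> / 2)) * (t0 * (Mu * G)^2)"
        using W(2)[OF x] W(1) sq t kappa by (intro mult_mono) auto
      finally show ?thesis .
    qed
    have d: "\<bar>remainder t x\<bar> \<le> N" using N[of "(t, x)"] t x by simp
    show "norm (quotient t x) \<le> (M1 * G) * F + (M0 * G) * V + W * (\<kappa> / 2) * (t0 * (Mu * G)^2) + N"
      unfolding quotient_def real_norm_def using a b c d
      by (intro order_trans[OF abs_triangle_ineq] add_mono)
  qed
qed

lemma quotient_limit: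
  assumes t0: "t0 > 0" "\<And>t. 0 \<le> t \<Longrightarrow> t \<le> t0 \<Longrightarrow> small t"
    and tn: "tn \<longlonglongrightarrow> 0" "\<And>n. tn n > 0" "\<And>n. tn n \<le> t0"
    and x: "x \<in> half_box k (R + 1)"
  shows "(\<lambda>n. quotient (tn n) x) \<longlonglongrightarrow> first_variation x"
proof -
  have xH: "x \<in> half_space k" using x half_box_subset by blast
  have sm: "small (tn n)" for n using t0 tn by (simp add: less_imp_le)
  have "(\<lambda>n. shear (tn n) x) \<longlonglongrightarrow> shear 0 x"
    unfolding shear_def by (intro tendsto_intros tn)
  then have shear: "(\<lambda>n. shear (tn n) x) \<longlonglongrightarrow> x" by (simp add: shear_0)
  note comp = continuous_on_tendsto_compose[OF _ shear xH always_eventually[OF allI[OF shear_half_space[OF sm xH]]]]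
  have "(\<lambda>n. remainder (fst (tn n, x)) (snd (tn n, x))) \<longlonglongrightarrow> remainder (fst (0::real, x)) (snd (0::real, x))"
  proof (rule continuous_on_tendsto_compose[of "{0..t0} \<times> half_box k (R + 1)" "\<lambda>z. remainder (fst z) (snd z)"
        "\<lambda>n. (tn n, x)" "(0, x)" sequentially])
    show "continuous_on ({0..t0} \<times> half_box k (R + 1)) (\<lambda>z. remainder (fst z) (snd z))"
      by (rule continuous_on_remainder) (use t0 half_box_subset[of k "R + 1"] in auto)
    show "(\<lambda>n. (tn n, x)) \<longlonglongrightarrow> (0, x)" by (intro tendsto_intros tn)
    show "\<forall>\<^sub>F n in sequentially. (tn n, x) \<in> {0..t0} \<times> half_box k (R + 1)"
      using tn x by (auto simp: less_imp_le)
  qed (use t0 x in auto)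
  then have remainder: "(\<lambda>n. remainder (tn n) x) \<longlonglongrightarrow> remainder 0 x" by simp
  obtain G where G: "G \<ge> 0" "\<And>x. \<bar>g x\<bar> \<le> G" using g_bounded by blast
  obtain Mu where Mu: "Mu \<ge> 0" "\<And>x y. x \<in> half_box k (R + 1) \<Longrightarrow> y \<in> half_box k (R + 1) \<Longrightarrow> norm (u x - u y) \<le> Mu * norm (x - y)"
    using continuous_partials_imp_Lipschitz[OF compact_half_box convex_half_box half_box_subset u_deriv u_C1] by blast
  have u0: "(\<lambda>n. (norm (u (shear (tn n) x) - u x))^2 / tn n) \<longlonglongrightarrow> 0"
  proof (rule tendsto_sandwich[OF _ _ tendsto_const])
    show "\<forall>\<^sub>F n in sequentially. 0 \<le> (norm (u (shear (tn n) x) - u x))^2 / tn n"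
      using tn by (auto simp: less_imp_le)
    show "\<forall>\<^sub>F n in sequentially. (norm (u (shear (tn n) x) - u x))^2 / tn n \<le> tn n * (Mu * G)^2"
    proof (intro always_eventually allI)
      fix n
      have "norm (u (shear (tn n) x) - u x) \<le> Mu * norm (x - shear (tn n) x)"
        using Mu(2)[OF x shear_half_box[OF sm x]] by (simp add: norm_minus_commute)
      also have "\<dots> \<le> Mu * (tn n * G)"
        using norm_shear_diff[of "tn n" x] tn(2)[of n] G Mu by (intro mult_left_mono) auto
      finally have "(norm (u (shear (tn n) x) - u x))^2 \<le> (Mu * (tn n * G))^2"
        by (intro power_mono) auto
      then show "(norm (u (shear (tn n) x) - u x))^2 / tn n \<le> tn n * (Mu * G)^2"
        using tn(2)[of n] by (simp add: pos_divide_le_eq power2_eq_square mult_ac)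
    qed
    show "(\<lambda>n. tn n * (Mu * G)^2) \<longlonglongrightarrow> 0" using tendsto_mult_left_zero[OF tn(1)] by blast
  qed
  have "(\<lambda>n. (w1 x - w1 (shear (tn n) x)) / tn n * frame_density p (grad (shear (tn n) x))
    + (w0 x - w0 (shear (tn n) x)) / tn n * potential \<kappa> (u (shear (tn n) x))
    + w0 x * \<kappa> / 2 * ((norm (u (shear (tn n) x) - u x))^2 / tn n) + remainder (tn n) x) \<longlonglongrightarrow>
    - (Dw1 x (axis i 1) * g x) * frame_density p (grad x) + - (Dw0 x (axis i 1) * g x) * potential \<kappa> (u x)
    + w0 x * \<kappa> / 2 * 0 + remainder 0 x"
    by (intro tendsto_add tendsto_mult weight_quotient_limit w1_deriv w0_deriv xH tn u0 remainder tendsto_const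
        comp[OF continuous_on_density] comp[OF continuous_on_pot])
  moreover have "- (Dw1 x (axis i 1) * g x) * frame_density p (grad x) + - (Dw0 x (axis i 1) * g x) * potential \<kappa> (u x)
    + w0 x * \<kappa> / 2 * 0 + remainder 0 x = first_variation x"
    unfolding remainder_def first_variation_def by (simp add: shear_0 shear_grad_0 algebra_simps)
  ultimately show ?thesis unfolding quotient_def by (simp add: mult.assoc)
qed

text \<open>Dominated convergence on the half box along t0/(n+1). All functions vanish outside the
  box, so the sign obtained on the half space for each t passes to the limit.\<close>

lemma first_variation_nonneg:
  "first_variation integrable_on half_space k" "0 \<le> integral (half_space k) first_variation"
proof -
  let ?Q = "half_box k (R + 1)"
  obtain t0 where t0: "t0 > 0" "\<And>t. 0 \<le> t \<Longrightarrow> t \<le> t0 \<Longrightarrow> small t" using ex_small by blast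
  define tn where "tn n = t0 / real (Suc n)" for n
  have tn: "tn \<longlonglongrightarrow> 0" "\<And>n. tn n > 0" "\<And>n. tn n \<le> t0"
    unfolding tn_def using t0
    by (auto intro!: LIMSEQ_Suc[OF lim_const_over_n] simp: divide_le_eq mult_le_cancel_left1 simp del: of_nat_Suc)
  obtain B where B: "\<And>t x. 0 < t \<Longrightarrow> t \<le> t0 \<Longrightarrow> x \<in> ?Q \<Longrightarrow> norm (quotient t x) \<le> B"
    using quotient_bounded[OF t0] by blast
  have sm: "small (tn n)" for n using t0 tn by (simp add: less_imp_le)
  have qi: "quotient (tn n) integrable_on ?Q" for n by (rule quotient_integrable_half_box[OF sm])
  have Bi: "(\<lambda>_. B) integrable_on ?Q" unfolding half_box_def by (rule integrable_const)
  have bd: "norm (quotient (tn n) x) \<le> B" if "x \<in> ?Q" for n x by (rule B[OF tn(2,3) that])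
  have fi: "first_variation integrable_on ?Q"
    by (rule dominated_convergence(1)[OF qi Bi bd quotient_limit[OF t0 tn]])
  have "(\<lambda>n. integral ?Q (quotient (tn n))) \<longlonglongrightarrow> integral ?Q first_variation"
    by (rule dominated_convergence(2)[OF qi Bi bd quotient_limit[OF t0 tn]])
  moreover have "0 \<le> integral ?Q (quotient (tn n))" for n
    using integral_quotient_nonneg[OF sm tn(2)] quotient_integrable(2)[OF sm] by simp
  ultimately have "0 \<le> integral ?Q first_variation" by (intro LIMSEQ_le_const) auto
  moreover have "(first_variation has_integral integral ?Q first_variation) (half_space k)"
    by (rule has_integral_on_superset[OF integrable_integral[OF fi] first_variation_zero half_box_subset])
  ultimately show "first_variation integrable_on half_space k" "0 \<le> integral (half_space k) first_variation"
    by (auto simp: has_integral_iff)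
qed

end

section \<open>Cutoffs and the radial variation\<close>

lemma has_real_derivative_pos_part_sq: "((\<lambda>s::real. (max 0 s)^2) has_real_derivative 2 * max 0 s) (at s)"
proof -
  consider "s > 0" | "s < 0" | "s = 0" by linarith
  then show ?thesis
  proof cases
    case 1
    have "((\<lambda>s::real. s^2) has_real_derivative 2 * max 0 s) (at s)"
      using 1 by (auto intro!: derivative_eq_intros)
    then show ?thesis
      by (rule has_field_derivative_transform_within_open[of _ _ _ "{0<..}"]) (use 1 in auto)
  next
    case 2
    have "((\<lambda>s::real. 0) has_real_derivative 2 * max 0 s) (at s)"
      using 2 by (auto intro!: derivative_eq_intros)
    then show ?thesis
      by (rule has_field_derivative_transform_within_open[of _ _ _ "{..<0}"]) (use 2 in auto)
  next
    case 3
    have "isCont (\<lambda>z::real. max 0 z) 0" by (intro continuous_intros)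
    moreover have "(max 0 z)^2 - (max 0 0)^2 = max 0 z * (z - 0)" for z :: real
      by (simp add: max_def power2_eq_square)
    ultimately show ?thesis unfolding CARAT_DERIV 3 by (intro exI[of _ "\<lambda>z. max 0 z"]) simp
  qed
qed

text \<open>The quadratic spline whose derivative is the tent of height 2 over the unit interval.
  Positive parts express it in closed form, and C^1 regularity is exactly what the variation fields
  ask for.\<close>

definition step :: "real \<Rightarrow> real" where
  "step s = 2 * ((max 0 s)^2 - 2 * (max 0 (s - 1/2))^2 + (max 0 (s - 1))^2)"

definition step' :: "real \<Rightarrow> real" where
  "step' s = 4 * (max 0 s - 2 * max 0 (s - 1/2) + max 0 (s - 1))"

lemma step_deriv: "(step has_real_derivative step' s) (at s)"
proof -
  have *: "((\<lambda>s. (max 0 (s - a))^2) has_real_derivative 2 * max 0 (s - a)) (at s)" for a :: real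
  proof -
    have "((\<lambda>s. s - a) has_real_derivative 1) (at s)" by (auto intro!: derivative_eq_intros)
    from DERIV_chain2[of "\<lambda>s. (max 0 s)^2" _ "\<lambda>s. s - a" s 1 UNIV, OF has_real_derivative_pos_part_sq this]
    show ?thesis by simp
  qed
  from DERIV_cmult[OF DERIV_add[OF DERIV_diff[OF has_real_derivative_pos_part_sq[of s]
        DERIV_cmult[OF *[of "1/2"], of 2]] *[of 1]], of 2]
  show ?thesis
    unfolding step_def[abs_def] step'_def by (simp add: algebra_simps)
qed

lemma step_eq_0: "s \<le> 0 \<Longrightarrow> step s = 0"
  by (simp add: step_def)

lemma step_eq_1: "s \<ge> 1 \<Longrightarrow> step s = 1"
  by (simp add: step_def max_def power2_eq_square algebra_simps)

lemma step'_eq_0: "s \<le> 0 \<or> s \<ge> 1 \<Longrightarrow> step' s = 0"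
  by (auto simp: step'_def max_def)

lemma step'_bounds: "0 \<le> step' s" "step' s \<le> 2"
  by (auto simp: step'_def max_def)

lemma step_bounds: "0 \<le> step s" "step s \<le> 1"
proof -
  have mono: "step a \<le> step b" if "a \<le> b" for a b
    by (rule DERIV_nonneg_imp_nondecreasing[OF that]) (use step_deriv step'_bounds in blast)
  have "step (min 0 s) \<le> step s" "step s \<le> step (max 1 s)" by (auto intro!: mono)
  then show "0 \<le> step s" "step s \<le> 1" by (simp_all add: step_eq_0 step_eq_1)
qed

lemma continuous_on_step': "continuous_on S step'"
  unfolding step'_def by (intro continuous_intros)

lemma continuous_on_step: "continuous_on S step"
  unfolding step_def by (intro continuous_intros)

text \<open>It is 1 where \<alpha> ln(1 + |x|^2) is at most 1 and 0 where it is at least 2. The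
  logarithm makes the radial derivative x . grad of order \<alpha> on the whole transition region,
  which a cutoff on comparable radii cannot achieve.\<close>

definition log_cutoff :: "real \<Rightarrow> 'a::euclidean_space \<Rightarrow> real" where
  "log_cutoff \<alpha> x = 1 - step (\<alpha> * ln (1 + x \<bullet> x) - 1)"

text \<open>Normalised so that the gradient of the cutoff is minus this number times x.\<close>

definition log_slope :: "real \<Rightarrow> 'a::euclidean_space \<Rightarrow> real" where
  "log_slope \<alpha> x = step' (\<alpha> * ln (1 + x \<bullet> x) - 1) * (2 * \<alpha>) / (1 + x \<bullet> x)"

lemma one_plus_inner_pos: "1 + x \<bullet> x > 0"
  by (simp add: add_pos_nonneg)

lemma log_cutoff_deriv:
  "(log_cutoff \<alpha> has_derivative (\<lambda>v. - (log_slope \<alpha> x * (x \<bullet> v)))) (at x)"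
proof -
  have "((\<lambda>x. \<alpha> * ln (1 + x \<bullet> x) - 1) has_derivative (\<lambda>v. \<alpha> * (2 * (x \<bullet> v) / (1 + x \<bullet> x)))) (at x)"
    using one_plus_inner_pos[of x]
    by (auto intro!: derivative_eq_intros simp: inner_commute divide_inverse)
  from has_derivative_compose[OF this step_deriv[unfolded has_field_derivative_def]]
  have "((\<lambda>x. step (\<alpha> * ln (1 + x \<bullet> x) - 1)) has_derivative
     (\<lambda>v. step' (\<alpha> * ln (1 + x \<bullet> x) - 1) * (\<alpha> * (2 * (x \<bullet> v) / (1 + x \<bullet> x))))) (at x)" .
  from has_derivative_diff[OF has_derivative_const[of 1] this]
  show ?thesis unfolding log_cutoff_def log_slope_def by (simp add: mult_ac)
qed

lemma log_cutoff_bounds: "0 \<le> log_cutoff \<alpha> x" "log_cutoff \<alpha> x \<le> 1"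
  unfolding log_cutoff_def using step_bounds by simp_all

lemma log_cutoff_eq_1: "\<alpha> * ln (1 + x \<bullet> x) \<le> 1 \<Longrightarrow> log_cutoff \<alpha> x = 1"
  by (simp add: log_cutoff_def step_eq_0)

lemma log_cutoff_support:
  assumes "\<alpha> > 0" "log_cutoff \<alpha> x \<noteq> 0"
  shows "norm x \<le> exp (1 / \<alpha>)"
proof -
  have "\<alpha> * ln (1 + x \<bullet> x) < 2"
    using assms step_eq_1[of "\<alpha> * ln (1 + x \<bullet> x) - 1"] unfolding log_cutoff_def by force
  then have "ln (1 + x \<bullet> x) < 2 / \<alpha>" using assms by (simp add: pos_less_divide_eq mult.commute)
  then have "1 + x \<bullet> x < exp (2 / \<alpha>)" using one_plus_inner_pos[of x] by (metis exp_less_mono exp_ln)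
  also have "\<dots> = (exp (1 / \<alpha>))^2" by (simp add: power2_eq_square flip: exp_add)
  finally have "(norm x)^2 \<le> (exp (1 / \<alpha>))^2" by (simp add: power2_norm_eq_inner)
  then show ?thesis by (rule power2_le_imp_le) simp
qed

text \<open>The tent is at most 2 and |x|^2 / (1 + |x|^2) is at most 1, which gives 2 times
  2\<alpha>. The factor |x|^2 is the one that the radial field produces.\<close>

lemma log_slope_bounds:
  assumes "\<alpha> \<ge> 0"
  shows "0 \<le> log_slope \<alpha> x" "log_slope \<alpha> x * (norm x)^2 \<le> 4 * \<alpha>"
proof -
  show "0 \<le> log_slope \<alpha> x" unfolding log_slope_def
    using assms step'_bounds one_plus_inner_pos[of x] by (intro divide_nonneg_pos mult_nonneg_nonneg) auto
  have "step' (\<alpha> * ln (1 + x \<bullet> x) - 1) * (2 * \<alpha>) * (x \<bullet> x) \<le> (2 * (2 * \<alpha>)) * (1 + x \<bullet> x)"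
    using assms step'_bounds by (intro mult_mono) auto
  then show "log_slope \<alpha> x * (norm x)^2 \<le> 4 * \<alpha>"
    unfolding log_slope_def power2_norm_eq_inner using one_plus_inner_pos[of x]
    by (simp add: pos_divide_le_eq)
qed

lemma continuous_on_log_cutoff: "continuous_on S (log_cutoff \<alpha>)"
  by (rule has_derivative_continuous_on[OF has_derivative_at_withinI[OF log_cutoff_deriv]])

lemma continuous_on_log_slope:
  fixes S :: "'a::euclidean_space set"
  shows "continuous_on S (log_slope \<alpha>)"
proof -
  have nz: "1 + x \<bullet> x \<noteq> 0" for x :: 'a using one_plus_inner_pos[of x] by simp
  have "continuous_on S (\<lambda>x. \<alpha> * ln (1 + x \<bullet> x) - 1)"
    by (intro continuous_intros) (use nz in auto)
  then have "continuous_on S (\<lambda>x. step' (\<alpha> * ln (1 + x \<bullet> x) - 1))"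
    by (rule continuous_on_compose2[OF continuous_on_step'[of UNIV]]) auto
  then show ?thesis
    unfolding log_slope_def by (intro continuous_intros) (use nz in auto)
qed

text \<open>The second factor vanishes up to height d and equals 1 from height 2d on; the shift by 1
  keeps the support away from the boundary.\<close>

definition product_cutoff :: "real \<Rightarrow> real \<Rightarrow> 'm::finite \<Rightarrow> real^'m \<Rightarrow> real" where
  "product_cutoff \<alpha> d k x = log_cutoff \<alpha> x * step (x $ k / d - 1)"

definition product_cutoff_deriv :: "real \<Rightarrow> real \<Rightarrow> 'm::finite \<Rightarrow> real^'m \<Rightarrow> real^'m \<Rightarrow> real" where
  "product_cutoff_deriv \<alpha> d k x v = log_cutoff \<alpha> x * (step' (x $ k / d - 1) / d) * (v $ k)
     - step (x $ k / d - 1) * log_slope \<alpha> x * (x \<bullet> v)"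

lemma has_derivative_product_cutoff:
  fixes k :: "'m::finite"
  shows
  "(product_cutoff \<alpha> d k has_derivative product_cutoff_deriv \<alpha> d k x) (at x)"
proof -
  have "((\<lambda>x::real^'m. x $ k / d - 1) has_derivative (\<lambda>v. v $ k / d)) (at x)"
    unfolding divide_inverse
    by (auto intro!: derivative_eq_intros bounded_linear_imp_has_derivative bounded_linear_vec_nth)
  from has_derivative_compose[OF this step_deriv[unfolded has_field_derivative_def]]
  have "((\<lambda>x::real^'m. step (x $ k / d - 1)) has_derivative (\<lambda>v. step' (x $ k / d - 1) * (v $ k / d))) (at x)" .
  from has_derivative_mult[OF log_cutoff_deriv[of \<alpha> x] this]
  show ?thesis
    unfolding product_cutoff_def[abs_def] product_cutoff_deriv_def[abs_def]
    by (simp add: algebra_simps)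
qed

lemma continuous_on_product_cutoff_deriv:
  fixes k :: "'m::finite"
  shows
  "continuous_on S (\<lambda>x. product_cutoff_deriv \<alpha> d k x v)"
proof -
  have c: "continuous_on S (\<lambda>x::real^'m. x $ k / d - 1)"
    unfolding divide_inverse by (intro continuous_intros)
  have "continuous_on S (\<lambda>x::real^'m. step (x $ k / d - 1))" "continuous_on S (\<lambda>x::real^'m. step' (x $ k / d - 1))"
    by (rule continuous_on_compose2[OF continuous_on_step[of UNIV] c] continuous_on_compose2[OF continuous_on_step'[of UNIV] c]; simp)+
  then show ?thesis
    unfolding product_cutoff_deriv_def divide_inverse
    by (intro continuous_on_diff continuous_on_mult continuous_on_const continuous_on_inner continuous_on_id
        continuous_on_log_cutoff continuous_on_log_slope)
qed

lemma product_cutoff_support: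
  assumes "\<alpha> > 0" "d > 0" "product_cutoff \<alpha> d k x \<noteq> 0"
  shows "d \<le> x $ k \<and> norm x \<le> exp (1 / \<alpha>)"
proof
  show "norm x \<le> exp (1 / \<alpha>)"
    using assms log_cutoff_support by (auto simp: product_cutoff_def)
  have "\<not> x $ k / d - 1 \<le> 0" using assms step_eq_0 by (auto simp: product_cutoff_def)
  then show "d \<le> x $ k" using assms by (simp add: field_simps)
qed

context weighted_weak_solution
begin

section \<open>The Pohozaev inequality for a cut-off radial field\<close>

lemma Du_expand: "x \<in> half_space k \<Longrightarrow> Du x v = (\<Sum>j\<in>UNIV. v $ j *\<^sub>R grad x j)"
  unfolding grad_def by (rule linear_axis_expansion[OF linear_Du])

text \<open>The field \<zeta> x has derivative \<zeta> times the identity plus a rank-one term in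
  the gradient of \<zeta>. Contracted with the stress, the identity part gives 2p \<zeta> times the
  density by Euler's identity, while the divergence contributes m \<zeta>; this is the origin of m -
  2p for the gradient part and of m for the potential.\<close>

lemma radial_first_variation:
  assumes \<zeta>: "\<And>x. (\<zeta> has_derivative D\<zeta> x) (at x)" "\<And>j. continuous_on UNIV (\<lambda>x. D\<zeta> x (axis j 1))"
    and supp: "\<delta> > 0" "R \<ge> 0" "\<And>x. \<zeta> x \<noteq> 0 \<Longrightarrow> \<delta> \<le> x $ k \<and> norm x \<le> R"
  shows "\<exists>I\<ge>0. ((\<lambda>x. w1 x * (\<Sum>j\<in>UNIV. D\<zeta> x (axis j 1) * (sigma_frame p (grad x) j \<bullet> Du x x))
     - D\<zeta> x x * energy x
     - \<zeta> x * ((Dw1 x x + (real CARD('m) - 2 * p) * w1 x) * frame_density p (grad x)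
            + (Dw0 x x + real CARD('m) * w0 x) * potential \<kappa> (u x))) has_integral I) (half_space k)"
proof -
  define Dg where "Dg i x v = v $ i * \<zeta> x + x $ i * D\<zeta> x v" for i x v
  have sv: "shear_variation k p \<kappa> w1 w0 Dw1 Dw0 u Du (\<lambda>x. x $ i * \<zeta> x) (Dg i) \<delta> R" for i
  proof (unfold_locales)
    show "((\<lambda>x. x $ i * \<zeta> x) has_derivative Dg i x) (at x)" for x
      unfolding Dg_def
      by (auto intro!: derivative_eq_intros bounded_linear_imp_has_derivative bounded_linear_vec_nth \<zeta>)
    show "continuous_on UNIV (\<lambda>x. Dg i x (axis j 1))" for j
      unfolding Dg_def using \<zeta>
      by (intro continuous_on_add continuous_on_mult continuous_on_const continuous_on_component continuous_on_id)
         (auto intro!: has_derivative_continuous_on[of _ \<zeta> D\<zeta>])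
    show "\<delta> \<le> x $ k \<and> norm x \<le> R" if "x $ i * \<zeta> x \<noteq> 0" for x using supp that by auto
  qed (use supp in auto)
  let ?f = "\<lambda>i x. w1 x * (\<Sum>j\<in>UNIV. Dg i x (axis j 1) * (sigma_frame p (grad x) j \<bullet> grad x i))
    - (Dw1 x (axis i 1) * (x $ i * \<zeta> x) + w1 x * Dg i x (axis i 1)) * frame_density p (grad x)
    - (Dw0 x (axis i 1) * (x $ i * \<zeta> x) + w0 x * Dg i x (axis i 1)) * potential \<kappa> (u x)"
  have "?f i integrable_on half_space k" "0 \<le> integral (half_space k) (?f i)" for i
    using shear_variation.first_variation_nonneg[OF sv, of i i]
      shear_variation.first_variation_def[OF sv, of i i, abs_def] by simp_all
  then have "((\<lambda>x. \<Sum>i\<in>UNIV. ?f i x) has_integral (\<Sum>i\<in>UNIV. integral (half_space k) (?f i))) (half_space k)"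
    "0 \<le> (\<Sum>i\<in>UNIV. integral (half_space k) (?f i))"
    by (auto intro!: has_integral_sum sum_nonneg simp: integrable_integral)
  moreover have "(\<Sum>i\<in>UNIV. ?f i x) = w1 x * (\<Sum>j\<in>UNIV. D\<zeta> x (axis j 1) * (sigma_frame p (grad x) j \<bullet> Du x x))
     - D\<zeta> x x * energy x
     - \<zeta> x * ((Dw1 x x + (real CARD('m) - 2 * p) * w1 x) * frame_density p (grad x)
            + (Dw0 x x + real CARD('m) * w0 x) * potential \<kappa> (u x))" if x: "x \<in> half_space k" for x
  proof -
    let ?F = "frame_density p (grad x)" and ?V = "potential \<kappa> (u x)"
    let ?\<sigma> = "sigma_frame p (grad x)"
    have D1: "Dw1 x x = (\<Sum>i\<in>UNIV. Dw1 x (axis i 1) * x $ i)"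
      using linear_axis_expansion[OF has_derivative_linear[OF w1_deriv[OF x]], of x] by (simp add: mult.commute)
    have D0: "Dw0 x x = (\<Sum>i\<in>UNIV. Dw0 x (axis i 1) * x $ i)"
      using linear_axis_expansion[OF has_derivative_linear[OF w0_deriv[OF x]], of x] by (simp add: mult.commute)
    have DZ: "D\<zeta> x x = (\<Sum>i\<in>UNIV. x $ i * D\<zeta> x (axis i 1))"
      using linear_axis_expansion[OF has_derivative_linear[OF \<zeta>(1)], of x x] by simp
    have Dgii: "(\<Sum>i\<in>UNIV. Dg i x (axis i 1)) = real CARD('m) * \<zeta> x + D\<zeta> x x"
      unfolding Dg_def DZ by (simp add: sum.distrib)
    have "(\<Sum>i\<in>UNIV. \<Sum>j\<in>UNIV. Dg i x (axis j 1) * (?\<sigma> j \<bullet> grad x i))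
      = (\<Sum>i\<in>UNIV. \<Sum>j\<in>UNIV. (axis j 1 $ i * \<zeta> x) * (?\<sigma> j \<bullet> grad x i))
       + (\<Sum>i\<in>UNIV. \<Sum>j\<in>UNIV. (x $ i * D\<zeta> x (axis j 1)) * (?\<sigma> j \<bullet> grad x i))"
      unfolding Dg_def by (simp add: distrib_right sum.distrib)
    also have "(\<Sum>i\<in>UNIV. \<Sum>j\<in>UNIV. (axis j 1 $ i * \<zeta> x) * (?\<sigma> j \<bullet> grad x i))
       = (\<Sum>i\<in>UNIV. \<zeta> x * (?\<sigma> i \<bullet> grad x i))"
    proof (rule sum.cong[OF refl])
      fix i
      have "(\<Sum>j\<in>UNIV. (axis j 1 $ i * \<zeta> x) * (?\<sigma> j \<bullet> grad x i))
         = (\<Sum>j\<in>UNIV. if i = j then \<zeta> x * (?\<sigma> j \<bullet> grad x i) else 0)"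
        by (rule sum.cong) (auto simp: axis_def)
      then show "(\<Sum>j\<in>UNIV. (axis j 1 $ i * \<zeta> x) * (?\<sigma> j \<bullet> grad x i)) = \<zeta> x * (?\<sigma> i \<bullet> grad x i)"
        by simp
    qed
    also have "\<dots> = \<zeta> x * (2 * p * ?F)"
      using sigma_frame_Euler[OF p2, of "grad x"] by (simp add: sum_distrib_left[symmetric])
    also have "(\<Sum>i\<in>UNIV. \<Sum>j\<in>UNIV. (x $ i * D\<zeta> x (axis j 1)) * (?\<sigma> j \<bullet> grad x i))
       = (\<Sum>j\<in>UNIV. \<Sum>i\<in>UNIV. (x $ i * D\<zeta> x (axis j 1)) * (?\<sigma> j \<bullet> grad x i))"
      by (rule sum.swap)
    also have "\<dots> = (\<Sum>j\<in>UNIV. D\<zeta> x (axis j 1) * (?\<sigma> j \<bullet> Du x x))"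
      unfolding Du_expand[OF x] by (simp add: inner_sum_right sum_distrib_left mult_ac)
    finally have S: "(\<Sum>i\<in>UNIV. \<Sum>j\<in>UNIV. Dg i x (axis j 1) * (?\<sigma> j \<bullet> grad x i))
       = \<zeta> x * (2 * p * ?F) + (\<Sum>j\<in>UNIV. D\<zeta> x (axis j 1) * (?\<sigma> j \<bullet> Du x x))" .
    have T: "(\<Sum>i\<in>UNIV. Dw x (axis i 1) * (x $ i * \<zeta> x) + w x * Dg i x (axis i 1))
        = (\<Sum>i\<in>UNIV. Dw x (axis i 1) * x $ i) * \<zeta> x + w x * (real CARD('m) * \<zeta> x + D\<zeta> x x)"
      for w :: "real^'m \<Rightarrow> real" and Dw :: "real^'m \<Rightarrow> real^'m \<Rightarrow> real"
      unfolding Dgii[symmetric] by (simp add: sum.distrib sum_distrib_left sum_distrib_right mult.assoc)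
    have "(\<Sum>i\<in>UNIV. ?f i x) = w1 x * (\<Sum>i\<in>UNIV. \<Sum>j\<in>UNIV. Dg i x (axis j 1) * (?\<sigma> j \<bullet> grad x i))
      - (\<Sum>i\<in>UNIV. Dw1 x (axis i 1) * (x $ i * \<zeta> x) + w1 x * Dg i x (axis i 1)) * ?F
      - (\<Sum>i\<in>UNIV. Dw0 x (axis i 1) * (x $ i * \<zeta> x) + w0 x * Dg i x (axis i 1)) * ?V"
      by (simp only: sum_subtractf sum_distrib_left sum_distrib_right)
    then show ?thesis
      unfolding S T D1[symmetric] D0[symmetric] energy_def by (simp add: algebra_simps)
  qed
  ultimately show ?thesis
    by (intro exI[of _ "\<Sum>i\<in>UNIV. integral (half_space k) (?f i)"] conjI)
       (auto intro: has_integral_cong[THEN iffD1, rotated] simp del: half_space_simps)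
qed

section \<open>Radial energy flux near the boundary\<close>

definition flux :: "real^'m \<Rightarrow> real" where
  "flux x = w1 x * (sigma_frame p (grad x) k \<bullet> Du x x)"

lemma continuous_on_flux: "continuous_on (half_space k) flux"
proof -
  have "continuous_on (half_space k) (\<lambda>x. w1 x * (sigma_frame p (grad x) k \<bullet> (\<Sum>j\<in>UNIV. x $ j *\<^sub>R grad x j)))"
    by (intro continuous_on_mult continuous_on_inner continuous_on_sum continuous_on_scaleR continuous_on_w1
        continuous_on_sigma continuous_on_grad continuous_on_component continuous_on_id)
  then show ?thesis
    by (rule continuous_on_eq) (simp only: flux_def Du_expand)
qed

text \<open>Orthogonality reduces the stress in the normal direction to a multiple of the normal
  derivative. At a boundary point the position vector is tangential, so its image under
  \<open>Du\<close> combines tangential derivatives only and is orthogonal to that multiple.\<close>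

lemma flux_boundary:
  assumes orth: "\<And>j. j \<noteq> k \<Longrightarrow> grad x k \<bullet> grad x j = 0" and x: "x $ k = 0"
  shows "flux x = 0"
proof -
  have *: "(grad x j \<bullet> grad x k) *\<^sub>R grad x j = (if j = k then (grad x k \<bullet> grad x k) *\<^sub>R grad x k else 0)" for j
    using orth[of j] inner_commute[of "grad x j" "grad x k"] by (cases "j = k") simp_all
  have "(\<Sum>j\<in>UNIV. (grad x j \<bullet> grad x k) *\<^sub>R grad x j) = (grad x k \<bullet> grad x k) *\<^sub>R grad x k"
    by (rule trans[OF sum.cong[OF refl *]]) simp
  moreover have "\<exists>a. A *\<^sub>R (B *\<^sub>R v) + C *\<^sub>R v = a *\<^sub>R v" for A B C and v :: "real^'n"
    by (metis scaleR_add_left scaleR_scaleR)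
  ultimately obtain a where "sigma_frame p (grad x) k = a *\<^sub>R grad x k"
    unfolding sigma_frame_def by metis
  moreover have "x $ j * (grad x k \<bullet> grad x j) = 0" for j
    using x orth[of j] by (cases "j = k") simp_all
  then have "grad x k \<bullet> Du x x = 0"
    using x by (auto simp: Du_expand inner_sum_right intro!: sum.neutral)
  ultimately show ?thesis by (simp add: flux_def)
qed

text \<open>Uniform continuity on the compact box, comparing x with its foot point on the boundary,
  where the flux vanishes. The foot point stays in the box.\<close>

lemma flux_small:
  assumes orth: "\<And>x j. x $ k = 0 \<Longrightarrow> j \<noteq> k \<Longrightarrow> grad x k \<bullet> grad x j = 0"
    and e: "e > 0" and R: "R \<ge> 0"
  obtains d where "d > 0" "\<And>x. x \<in> half_box k R \<Longrightarrow> x $ k \<le> d \<Longrightarrow> \<bar>flux x\<bar> \<le> e"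
proof -
  have "uniformly_continuous_on (half_box k R) flux"
    unfolding half_box_def
    by (intro compact_uniformly_continuous compact_cbox continuous_on_subset[OF continuous_on_flux])
       (use half_box_subset[of k R] in \<open>simp add: half_box_def\<close>)
  then obtain d where d: "d > 0"
    "\<And>x x'. x \<in> half_box k R \<Longrightarrow> x' \<in> half_box k R \<Longrightarrow> dist x' x < d \<Longrightarrow> dist (flux x') (flux x) < e"
    using e by (metis uniformly_continuous_onE)
  show ?thesis
  proof (rule that)
    show "d / 2 > 0" using d by simp
    fix x assume x: "x \<in> half_box k R" "x $ k \<le> d / 2"
    define x' where "x' = x - (x $ k) *\<^sub>R axis k 1"
    have comp: "x' $ j = (if j = k then 0 else x $ j)" for j
      by (auto simp: x'_def axis_def)
    have "x' \<in> half_box k R"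
      using x R by (auto simp: mem_half_box comp)
    moreover have "dist x' x < d"
      using x R d(1) by (simp add: x'_def dist_norm norm_axis_1 mem_half_box)
    ultimately have "dist (flux x') (flux x) < e" using d x by blast
    moreover have "flux x' = 0" by (rule flux_boundary) (auto simp: comp intro: orth)
    ultimately show "\<bar>flux x\<bar> \<le> e" by (simp add: dist_norm)
  qed
qed

text \<open>The gradient of the logarithmic cutoff is radial, so the stress is contracted with x
  twice. The resulting |x|^2 is what the bound on \<open>log_slope\<close> absorbs, and the square
  of the dimension counts the terms.\<close>

lemma sum_sigma_radial_le:
  assumes C: "\<And>(B :: 'm \<Rightarrow> real^'n) j l. \<bar>sigma_frame p B j \<bullet> B l\<bar> \<le> C * frame_density p B"
    and x: "x \<in> half_space k"
  shows "\<bar>\<Sum>j\<in>UNIV. x $ j * (sigma_frame p (grad x) j \<bullet> Du x x)\<bar>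
    \<le> (norm x)^2 * ((real CARD('m))^2 * C * frame_density p (grad x))"
proof -
  have CF: "0 \<le> C * frame_density p (grad x)"
    using C[of "grad x" k k] by linarith
  have "\<bar>\<Sum>j\<in>UNIV. x $ j * (sigma_frame p (grad x) j \<bullet> Du x x)\<bar>
    = \<bar>\<Sum>j\<in>UNIV. \<Sum>l\<in>UNIV. (x $ j * x $ l) * (sigma_frame p (grad x) j \<bullet> grad x l)\<bar>"
    unfolding Du_expand[OF x] by (simp add: inner_sum_right sum_distrib_left mult.assoc)
  also have "\<dots> \<le> (\<Sum>j\<in>(UNIV::'m set). \<Sum>l\<in>(UNIV::'m set). (norm x * norm x) * (C * frame_density p (grad x)))"
  proof (intro order_trans[OF sum_abs] sum_mono order_trans[OF sum_abs])
    fix j l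
    have "\<bar>x $ j * x $ l\<bar> \<le> norm x * norm x"
      unfolding abs_mult by (intro mult_mono component_le_norm_cart) auto
    then show "\<bar>(x $ j * x $ l) * (sigma_frame p (grad x) j \<bullet> grad x l)\<bar> \<le> (norm x * norm x) * (C * frame_density p (grad x))"
      unfolding abs_mult[of "x $ j * x $ l"] by (intro mult_mono C) auto
  qed
  finally show ?thesis by (simp add: power2_eq_square mult_ac)
qed

definition strip :: "real \<Rightarrow> real \<Rightarrow> (real^'m) set" where
  "strip R d = cbox (\<chi> j. if j = k then 0 else - R) (\<chi> j. if j = k then 2 * d else R)"

lemma strip_subset: "strip R d \<subseteq> half_space k"
  unfolding strip_def by (rule subsetI, drule mem_box_cart[THEN iffD1, THEN spec[of _ k]]) simp

lemma mem_strip: "x \<in> half_box k R \<Longrightarrow> x $ k \<le> 2 * d \<Longrightarrow> x \<in> strip R d"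
  unfolding strip_def half_box_def mem_box_cart vec_lambda_beta by simp

text \<open>Linear in d: the thinness of the strip cancels the slope of order 1/d of the boundary
  cutoff.\<close>

lemma measure_strip_le:
  assumes "d \<ge> 0" "R \<ge> 0"
  shows "measure lborel (strip R d) \<le> 2 * d * (2 * R) ^ (CARD('m) - 1)"
proof -
  have "(\<Prod>j\<in>UNIV. (if j = k then 2 * d else R) - (if j = k then 0 else - R)) = 2 * d * (2 * R) ^ (CARD('m) - 1)"
  proof -
    have "(\<Prod>j\<in>UNIV. (if j = k then 2 * d else R) - (if j = k then 0 else - R))
       = (\<Prod>j\<in>UNIV. if j = k then 2 * d else 2 * R)"
      by (rule prod.cong) auto
    then show ?thesis by (simp add: prod.delta_remove card_Diff_singleton)
  qed
  then show ?thesis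
    unfolding strip_def content_cbox_if_cart using assms by simp
qed

text \<open>The growth conditions bound the terms weighted by the cutoff from below by c times the
  cut-off energy. On a box around x0 the cutoff is 1, so c times the energy there is at most the
  error from the cutoff derivatives, which is arbitrarily small. A continuous nonnegative function
  with zero integral vanishes at x0.\<close>

lemma energy_vanishes:
  assumes c: "c > 0"
    and rad1: "\<And>x. x \<in> half_space k \<Longrightarrow> c * w1 x \<le> Dw1 x x + (real CARD('m) - 2 * p) * w1 x"
    and rad0: "\<And>x. x \<in> half_space k \<Longrightarrow> c * w0 x \<le> Dw0 x x + real CARD('m) * w0 x"
    and orth: "\<And>x j. x $ k = 0 \<Longrightarrow> j \<noteq> k \<Longrightarrow> grad x k \<bullet> grad x j = 0"
    and x0: "x0 $ k > 0"
  shows "energy x0 = 0"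
proof -
  define \<rho> where "\<rho> = x0 $ k / 2"
  define a where "a = (\<chi> j. x0 $ j - \<rho>)"
  define b where "b = (\<chi> j. x0 $ j + \<rho>)"
  have \<rho>: "\<rho> > 0" using x0 by (simp add: \<rho>_def)
  have Q0k: "\<rho> \<le> x $ k" if "x \<in> cbox a b" for x
    using that by (auto simp: mem_box_cart a_def \<rho>_def dest!: spec[of _ k])
  have Q0: "cbox a b \<subseteq> half_space k" using Q0k \<rho> by force
  obtain N where N: "N \<ge> 0" "\<And>x. x \<in> cbox a b \<Longrightarrow> norm (ln (1 + x \<bullet> x)) \<le> N"
  proof (rule continuous_on_compact_norm_bound[of "cbox a b" "\<lambda>x. ln (1 + x \<bullet> x)"])
    have "1 + x \<bullet> x \<noteq> 0" for x :: "real^'m" using one_plus_inner_pos[of x] by simp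
    then show "continuous_on (cbox a b) (\<lambda>x. ln (1 + x \<bullet> x))" by (intro continuous_intros) auto
  qed (auto intro: that)
  obtain C where C: "C \<ge> 0" "\<And>(B :: 'm \<Rightarrow> real^'n) j l. \<bar>sigma_frame p B j \<bullet> B l\<bar> \<le> C * frame_density p B"
    using sigma_frame_inner_le[OF p2 pm] by blast
  \<comment> \<open>The summand 1 accounts for the divergence term, the other for the stress term;
    each comes with the factor 4\<alpha> from the logarithmic slope.\<close>
  define M where "M = 4 * (1 + (real CARD('m))^2 * C)"
  have M: "M \<ge> 0" unfolding M_def using C by (intro mult_nonneg_nonneg add_nonneg_nonneg) auto
  define E where "E = integral (half_space k) energy"
  have E: "E \<ge> 0" unfolding E_def by (rule integral_nonneg[OF energy_integrable energy_nonneg])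
  have eQ0: "energy integrable_on cbox a b"
    by (rule integrable_continuous[OF continuous_on_subset[OF continuous_on_energy Q0]])
  have main: "c * integral (cbox a b) energy \<le> M * \<alpha> * E + e"
    if \<alpha>: "\<alpha> > 0" "\<alpha> * N \<le> 1" and e: "e > 0" for \<alpha> e
  proof -
    define R where "R = exp (1 / \<alpha>)"
    have R: "R > 0" by (simp add: R_def)
    \<comment> \<open>Chosen so that the volume bound 2d (2R)^(m-1) of the strip times the flux
      bound 2e'/d is exactly e, whatever d is.\<close>
    define e' where "e' = e / (4 * (2 * R) ^ (CARD('m) - 1))"
    have e': "e' > 0" unfolding e'_def using e R by simp
    obtain d0 where d0: "d0 > 0" "\<And>x. x \<in> half_box k R \<Longrightarrow> x $ k \<le> d0 \<Longrightarrow> \<bar>flux x\<bar> \<le> e'"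
      using flux_small[OF orth e' less_imp_le[OF R]] by blast
    \<comment> \<open>The transition layer ends at height 2d: it lies where the flux is small and
      below the box around x0, on which the cutoff is therefore 1.\<close>
    define d where "d = min d0 \<rho> / 2"
    have d: "d > 0" "2 * d \<le> d0" "2 * d \<le> \<rho>" using d0 \<rho> by (auto simp: d_def)
    let ?\<zeta> = "product_cutoff \<alpha> d k" and ?D = "product_cutoff_deriv \<alpha> d k"
    let ?V = "\<lambda>x. w1 x * (\<Sum>j\<in>UNIV. ?D x (axis j 1) * (sigma_frame p (grad x) j \<bullet> Du x x))
     - ?D x x * energy x
     - ?\<zeta> x * ((Dw1 x x + (real CARD('m) - 2 * p) * w1 x) * frame_density p (grad x)
            + (Dw0 x x + real CARD('m) * w0 x) * potential \<kappa> (u x))"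
    obtain I where I: "I \<ge> 0" "(?V has_integral I) (half_space k)"
      using radial_first_variation[OF has_derivative_product_cutoff continuous_on_product_cutoff_deriv d(1)
          less_imp_le[OF R] product_cutoff_support[OF \<alpha>(1) d(1), folded R_def]] by blast
    \<comment> \<open>A pointwise majorant with known integral: the loss at infinity, the flux in
      the strip, and minus the gain on the box.\<close>
    let ?B = "\<lambda>x. M * \<alpha> * energy x + (if x \<in> strip R d then 2 * e' / d else 0)
       - c * (if x \<in> cbox a b then energy x else 0)"
    have "((\<lambda>_. 2 * e' / d) has_integral measure lborel (strip R d) *\<^sub>R (2 * e' / d)) (strip R d)"
      unfolding strip_def by (rule has_integral_const)
    then have B: "(?B has_integral M * \<alpha> * E + measure lborel (strip R d) *\<^sub>R (2 * e' / d)
        - c * integral (cbox a b) energy) (half_space k)"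
      unfolding E_def
      by (intro has_integral_diff has_integral_add has_integral_mult_right integrable_integral energy_integrable
          has_integral_restrict[OF strip_subset, THEN iffD2] has_integral_restrict[OF Q0, THEN iffD2] eQ0)
    have VB: "?V x \<le> ?B x" if x: "x \<in> half_space k" for x
    proof -
      define \<eta> s s' \<tau> F where "\<eta> = log_cutoff \<alpha> x" and "s = step (x $ k / d - 1)"
        and "s' = step' (x $ k / d - 1)" and "\<tau> = log_slope \<alpha> x" and "F = frame_density p (grad x)"
      have \<eta>: "0 \<le> \<eta>" "\<eta> \<le> 1" unfolding \<eta>_def by (rule log_cutoff_bounds)+
      have s: "0 \<le> s" "s \<le> 1" unfolding s_def by (rule step_bounds)+
      have s': "0 \<le> s'" "s' \<le> 2" unfolding s'_def by (rule step'_bounds)+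
      have \<tau>: "0 \<le> \<tau>" "\<tau> * (norm x)^2 \<le> 4 * \<alpha>" unfolding \<tau>_def using \<alpha> by (auto intro: log_slope_bounds)
      have s\<tau>: "s * (\<tau> * (norm x)^2) \<le> 4 * \<alpha>"
        using mult_mono[OF s(2) \<tau>(2)] \<tau>(1) s by simp
      have F: "F \<ge> 0" unfolding F_def by (rule density_nonneg)
      have en: "energy x \<ge> 0" by (rule energy_nonneg[OF x])
      have w1: "w1 x \<ge> 0" by (rule w1_nonneg[OF x])
      have pot: "potential \<kappa> (u x) \<ge> 0" by (rule potential_nonneg[OF kappa])
      have w1F: "w1 x * F \<le> energy x"
        unfolding energy_def F_def using w0_nonneg[OF x] pot by simp
      have Dxx: "?D x x = \<eta> * (s' / d) * (x $ k) - s * (\<tau> * (norm x)^2)"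
        unfolding product_cutoff_deriv_def \<eta>_def s_def s'_def \<tau>_def by (simp add: power2_norm_eq_inner)
      \<comment> \<open>The boundary cutoff increases with the height, so its radial derivative has
        the favourable sign despite being of order 1/d times the height; only the logarithmic cutoff
        costs something.\<close>
      have "- ?D x x \<le> 4 * \<alpha>"
      proof -
        have "0 \<le> \<eta> * (s' / d) * (x $ k)"
          using \<eta> s' d x by (intro mult_nonneg_nonneg divide_nonneg_pos) auto
        then show ?thesis unfolding Dxx using s\<tau> by linarith
      qed
      then have T1: "- ?D x x * energy x \<le> 4 * \<alpha> * energy x" using en by (rule mult_right_mono)
      define \<Sigma> where "\<Sigma> = (\<Sum>j\<in>UNIV. x $ j * (sigma_frame p (grad x) j \<bullet> Du x x))"
      have Dax: "?D x (axis j 1) = (if j = k then \<eta> * (s' / d) else 0) - s * \<tau> * x $ j" for j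
      proof -
        have "axis j (1::real) $ k = (if j = k then 1 else 0)" by (simp add: axis_def)
        then show ?thesis
          unfolding product_cutoff_deriv_def \<eta>_def s_def s'_def \<tau>_def by (simp add: inner_axis)
      qed
      have "(\<Sum>j\<in>UNIV. ?D x (axis j 1) * (sigma_frame p (grad x) j \<bullet> Du x x)) =
        (\<Sum>j\<in>UNIV. (if j = k then \<eta> * (s' / d) * (sigma_frame p (grad x) k \<bullet> Du x x) else 0)
           - s * \<tau> * (x $ j * (sigma_frame p (grad x) j \<bullet> Du x x)))"
        unfolding Dax by (rule sum.cong) (auto simp: algebra_simps)
      also have "\<dots> = \<eta> * (s' / d) * (sigma_frame p (grad x) k \<bullet> Du x x) - s * \<tau> * \<Sigma>"
        unfolding \<Sigma>_def by (simp add: sum_subtractf sum_distrib_left)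
      finally have sumD: "(\<Sum>j\<in>UNIV. ?D x (axis j 1) * (sigma_frame p (grad x) j \<bullet> Du x x)) =
        \<eta> * (s' / d) * (sigma_frame p (grad x) k \<bullet> Du x x) - s * \<tau> * \<Sigma>" .
      have "w1 x * (\<Sum>j\<in>UNIV. ?D x (axis j 1) * (sigma_frame p (grad x) j \<bullet> Du x x))
         = \<eta> * (s' / d) * flux x + w1 x * (s * \<tau> * (- \<Sigma>))"
        unfolding sumD flux_def by (simp add: algebra_simps)
      moreover have "w1 x * (s * \<tau> * (- \<Sigma>)) \<le> 4 * \<alpha> * ((real CARD('m))^2 * C) * energy x"
      proof -
        have "- \<Sigma> \<le> (norm x)^2 * ((real CARD('m))^2 * C * F)"
          using sum_sigma_radial_le[OF C(2) x] unfolding \<Sigma>_def F_def by linarith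
        then have "w1 x * (s * \<tau> * (- \<Sigma>)) \<le> w1 x * (s * \<tau> * ((norm x)^2 * ((real CARD('m))^2 * C * F)))"
          using w1 s \<tau> by (intro mult_left_mono) auto
        also have "\<dots> = (s * (\<tau> * (norm x)^2)) * ((real CARD('m))^2 * C) * (w1 x * F)"
          by (simp add: mult_ac)
        also have "\<dots> \<le> (4 * \<alpha>) * ((real CARD('m))^2 * C) * energy x"
          by (rule mult_mono[OF mult_right_mono[OF s\<tau>] w1F]) (use C \<alpha> w1 F in simp_all)
        finally show ?thesis .
      qed
      moreover have "\<eta> * (s' / d) * flux x \<le> (if x \<in> strip R d then 2 * e' / d else 0)"
      proof (cases "\<eta> = 0 \<or> s' = 0")
        case True
        then show ?thesis using e' d by auto
      next
        case False
        have "norm x \<le> R" unfolding R_def by (rule log_cutoff_support[OF \<alpha>(1)]) (use False in \<open>simp add: \<eta>_def\<close>)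
        then have xb: "x \<in> half_box k R" using x by (intro norm_le_imp_half_box) auto
        have "\<not> x $ k / d - 1 \<ge> 1" using False step'_eq_0 unfolding s'_def by blast
        then have xk: "x $ k \<le> 2 * d" using d by (simp add: field_simps)
        have "\<bar>flux x\<bar> \<le> e'" using d0(2)[OF xb] xk d by simp
        then have "\<eta> * (s' / d) * flux x \<le> \<eta> * (s' / d) * e'"
          using \<eta> s' d by (intro mult_left_mono) auto
        also have "\<dots> \<le> 1 * (2 / d) * e'"
          using \<eta> s' d e' by (intro mult_right_mono mult_mono divide_right_mono) auto
        finally show ?thesis using mem_strip[OF xb xk] by simp
      qed
      moreover have "c * (if x \<in> cbox a b then energy x else 0) \<le>
        ?\<zeta> x * ((Dw1 x x + (real CARD('m) - 2 * p) * w1 x) * frame_density p (grad x)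
            + (Dw0 x x + real CARD('m) * w0 x) * potential \<kappa> (u x))"
      proof -
        have \<zeta>: "0 \<le> ?\<zeta> x" unfolding product_cutoff_def using \<eta> s by (simp add: \<eta>_def s_def)
        have "(if x \<in> cbox a b then energy x else 0) \<le> ?\<zeta> x * energy x"
        proof (cases "x \<in> cbox a b")
          case True
          have "\<alpha> * ln (1 + x \<bullet> x) \<le> \<alpha> * N" using N(2)[OF True] \<alpha> by (intro mult_left_mono) auto
          then have "log_cutoff \<alpha> x = 1" using \<alpha> by (intro log_cutoff_eq_1) linarith
          moreover have "step (x $ k / d - 1) = 1"
            using Q0k[OF True] d by (intro step_eq_1) (simp add: field_simps)
          ultimately show ?thesis using True by (simp add: product_cutoff_def)
        next
          case False
          then show ?thesis using \<zeta> en by simp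
        qed
        then have "c * (if x \<in> cbox a b then energy x else 0) \<le> c * (?\<zeta> x * energy x)"
          using c by (intro mult_left_mono) auto
        also have "\<dots> = ?\<zeta> x * ((c * w1 x) * frame_density p (grad x) + (c * w0 x) * potential \<kappa> (u x))"
          by (simp add: energy_def algebra_simps)
        also have "\<dots> \<le> ?\<zeta> x * ((Dw1 x x + (real CARD('m) - 2 * p) * w1 x) * frame_density p (grad x)
            + (Dw0 x x + real CARD('m) * w0 x) * potential \<kappa> (u x))"
          using rad1[OF x] rad0[OF x] density_nonneg[of x] pot \<zeta>
          by (intro mult_left_mono add_mono mult_right_mono)
        finally show ?thesis .
      qed
      moreover have "M * \<alpha> * energy x = 4 * \<alpha> * energy x + 4 * \<alpha> * ((real CARD('m))^2 * C) * energy x"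
        unfolding M_def by (simp add: algebra_simps)
      ultimately show ?thesis using T1 by linarith
    qed
    have "I \<le> M * \<alpha> * E + measure lborel (strip R d) *\<^sub>R (2 * e' / d) - c * integral (cbox a b) energy"
      by (rule has_integral_le[OF I(2) B VB])
    moreover have "measure lborel (strip R d) *\<^sub>R (2 * e' / d) \<le> (2 * d * (2 * R) ^ (CARD('m) - 1)) * (2 * e' / d)"
      unfolding real_scaleR_def using measure_strip_le[of d R] d R e' by (intro mult_right_mono) auto
    moreover have "(2 * d * (2 * R) ^ (CARD('m) - 1)) * (2 * e' / d) = e"
      using d R by (simp add: e'_def field_simps)
    ultimately show ?thesis using I(1) by linarith
  qed
  have "c * integral (cbox a b) energy \<le> 0 + e" if e: "e > 0" for e
  proof -
    \<comment> \<open>The first entry makes the logarithmic cutoff equal to 1 on the box, the second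
      makes its error at most e/2. The added 1 avoids division by zero.\<close>
    define \<alpha> where "\<alpha> = min (1 / (N + 1)) (e / (2 * (M * E + 1)))"
    have ME: "M * E \<ge> 0" using M E by simp
    have \<alpha>: "\<alpha> > 0" unfolding \<alpha>_def using N e ME by (simp add: add_nonneg_pos)
    have "\<alpha> \<le> 1 / (N + 1)" by (simp add: \<alpha>_def)
    then have "\<alpha> * (N + 1) \<le> 1" using pos_le_divide_eq[of "N + 1" \<alpha> 1] N by linarith
    then have \<alpha>N: "\<alpha> * N \<le> 1" using \<alpha> by (simp add: distrib_left)
    have "\<alpha> \<le> e / (2 * (M * E + 1))" by (simp add: \<alpha>_def)
    moreover have "2 * (M * E + 1) > 0" using ME by (intro mult_pos_pos add_nonneg_pos) auto
    ultimately have "\<alpha> * (2 * (M * E + 1)) \<le> e" using pos_le_divide_eq[THEN iffD1] by blast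
    then have "M * \<alpha> * E \<le> e / 2" using \<alpha> by (simp add: algebra_simps)
    then show ?thesis using main[OF \<alpha> \<alpha>N, of "e / 2"] e by linarith
  qed
  then have "c * integral (cbox a b) energy \<le> 0" by (rule field_le_epsilon)
  then have "integral (cbox a b) energy \<le> 0" using c by (simp add: mult_le_0_iff)
  moreover have nn: "energy x \<ge> 0" if "x \<in> cbox a b" for x
    using energy_nonneg that Q0 by blast
  ultimately have "integral (cbox a b) energy = 0"
    using integral_nonneg[OF eQ0 nn] by linarith
  moreover have "x0 \<in> box a b" using \<rho> by (simp add: mem_box_cart a_def b_def)
  ultimately show ?thesis
    using integral_cbox_eq_0_iff[OF continuous_on_subset[OF continuous_on_energy Q0] _ nn] box_subset_cbox
    by blast
qed

end

section \<open>Conformal weights and the conclusion\<close>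

lemma grad_sq_scaleR: "grad_sq (\<lambda>j. c *\<^sub>R W j) = c^2 * grad_sq W"
  by (simp add: grad_sq_def power_mult_distrib sum_distrib_left)

lemma pullback_sq_scaleR: "pullback_sq (\<lambda>j. c *\<^sub>R W j) = c^4 * pullback_sq W"
proof -
  have "((c *\<^sub>R W i) \<bullet> (c *\<^sub>R W j))^2 = c^4 * (W i \<bullet> W j)^2" for i j
    by (simp add: power_mult_distrib flip: power_add mult.assoc power2_eq_square)
  then show ?thesis by (simp add: pullback_sq_def sum_distrib_left)
qed

lemma power_powr: "c > 0 \<Longrightarrow> (c ^ n) powr a = c powr (real n * a)" for c :: real
  by (subst powr_realpow[symmetric]) (simp_all only: powr_powr)

lemma frame_density_scaleR:
  assumes "c > 0"
  shows "frame_density p (\<lambda>j. c *\<^sub>R W j) = c powr (2 * p) * frame_density p W"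
proof -
  have "(c^2 * grad_sq W) powr p = c powr (2 * p) * grad_sq W powr p"
    using assms by (simp add: powr_mult power_powr grad_sq_nonneg)
  moreover have "(c^4 * pullback_sq W) powr (p/2) = c powr (2 * p) * pullback_sq W powr (p/2)"
    using assms by (simp add: powr_mult power_powr pullback_sq_nonneg)
  ultimately show ?thesis
    unfolding frame_density_def grad_sq_scaleR pullback_sq_scaleR by (simp add: algebra_simps)
qed

text \<open>A gradient of a function homogeneous of degree 2p is homogeneous of degree 2p - 1. In
  the pullback term the degrees are 2p - 4 and 3, in the other 2p - 2 and 1.\<close>

lemma sigma_frame_scaleR:
  fixes W :: "'m::finite \<Rightarrow> real^'n::finite"
  assumes c: "c > 0"
  shows "sigma_frame p (\<lambda>j. c *\<^sub>R W j) k = c powr (2 * p - 1) *\<^sub>R sigma_frame p W k"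
proof -
  have a: "(c^2 * grad_sq W) powr (p - 1) = c powr (2 * p - 2) * grad_sq W powr (p - 1)"
    using c by (simp add: powr_mult power_powr grad_sq_nonneg algebra_simps)
  have a': "c powr (2 * p - 2) * c = c powr (2 * p - 1)"
    using c powr_add[of c "2 * p - 2" 1] by simp
  have 1: "(c^2 * grad_sq W) powr (p - 1) * c = c powr (2 * p - 1) * grad_sq W powr (p - 1)"
    unfolding a a'[symmetric] by (simp only: mult_ac)
  have e: "real 4 * ((p - 2) / 2) = 2 * p - 4" by simp
  have b: "(c^4 * pullback_sq W) powr ((p - 2)/2) = c powr (2 * p - 4) * pullback_sq W powr ((p - 2)/2)"
    using c powr_mult[of "c^4" "pullback_sq W" "(p - 2)/2"]
    unfolding power_powr[OF c] e by (simp add: pullback_sq_nonneg)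
  have b': "c powr (2 * p - 4) * c^3 = c powr (2 * p - 1)"
    using c powr_add[of c "2 * p - 4" 3] by simp
  have 2: "(c^4 * pullback_sq W) powr ((p - 2)/2) * c^3 = c powr (2 * p - 1) * pullback_sq W powr ((p - 2)/2)"
    unfolding b b'[symmetric] by (simp only: mult_ac)
  have 3: "(\<Sum>j\<in>UNIV. ((c *\<^sub>R W j) \<bullet> (c *\<^sub>R W k)) *\<^sub>R (c *\<^sub>R W j)) = c^3 *\<^sub>R (\<Sum>j\<in>UNIV. (W j \<bullet> W k) *\<^sub>R W j)"
    by (simp add: scaleR_sum_right power3_eq_cube mult_ac)
  have "sigma_frame p (\<lambda>j. c *\<^sub>R W j) k =
     (real CARD('m) powr (p/2 - 1) * ((c^4 * pullback_sq W) powr ((p - 2)/2) * c^3)) *\<^sub>R (\<Sum>j\<in>UNIV. (W j \<bullet> W k) *\<^sub>R W j)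
     + ((real CARD('m) - 2*p) / p^2 * ((c^2 * grad_sq W) powr (p - 1) * c)) *\<^sub>R W k"
    unfolding sigma_frame_def grad_sq_scaleR pullback_sq_scaleR 3 by (simp add: mult.assoc)
  also have "\<dots> = c powr (2 * p - 1) *\<^sub>R sigma_frame p W k"
    unfolding 1 2 sigma_frame_def by (simp add: scaleR_add_right mult_ac)
  finally show ?thesis .
qed

text \<open>One family covers both weights. The volume form contributes the exponent m/2, and the
  orthonormal frame contributes -1/2 for each of the 2p gradient factors, which lowers the exponent
  to m/2 - p for the gradient part.\<close>

definition conformal_weight :: "(real^'m \<Rightarrow> real) \<Rightarrow> (real^'m \<Rightarrow> real) \<Rightarrow> real \<Rightarrow> real^'m \<Rightarrow> real" where
  "conformal_weight f \<phi> a x = exp (- \<phi> x) * f x powr a"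

lemma inverse_sqrt_powr: "t > 0 \<Longrightarrow> (1 / sqrt t) powr (2 * p) = t powr (- p)"
  by (simp add: powr_divide powr_minus_divide powr_half_sqrt[symmetric] powr_powr)

lemma frame_image_eq: "frame_image f Du x = (\<lambda>j. (1 / sqrt (f x)) *\<^sub>R Du x (axis j 1))"
  by (auto simp: frame_image_def)

lemma energy_integrand_conformal:
  fixes Du :: "real^'m::finite \<Rightarrow> real^'m \<Rightarrow> real^'n::finite"
  assumes f: "f x > 0"
  shows "energy_integrand p \<epsilon> f \<phi> u Du x =
    conformal_weight f \<phi> (real CARD('m) / 2 - p) x * frame_density p (\<lambda>j. Du x (axis j 1))
    + conformal_weight f \<phi> (real CARD('m) / 2) x * potential (1 / \<epsilon> ^ CARD('n)) (u x)"
proof -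
  have "energy_density p \<epsilon> (frame_image f Du x) (u x) =
     f x powr (- p) * frame_density p (\<lambda>j. Du x (axis j 1)) + potential (1 / \<epsilon> ^ CARD('n)) (u x)"
    using f frame_density_scaleR[of "1 / sqrt (f x)" p "\<lambda>j. Du x (axis j 1)"]
    unfolding energy_density_def frame_image_eq frame_density_def[symmetric]
    by (simp add: inverse_sqrt_powr potential_def)
  moreover have "f x powr (- p) * f x powr (real CARD('m) / 2) = f x powr (real CARD('m) / 2 - p)"
    by (simp add: powr_add[symmetric])
  ultimately show ?thesis
    unfolding energy_integrand_def conformal_weight_def by (simp add: distrib_right)
qed

text \<open>The stress has degree 2p - 1 in the frame scaling and the derivative of the test map
  adds one more factor, so the weight is the same as for the gradient part of the energy.\<close>

lemma weak_integrand_conformal: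
  fixes Du :: "real^'m::finite \<Rightarrow> real^'m \<Rightarrow> real^'n::finite"
  assumes f: "f x > 0"
  shows "weak_integrand p \<epsilon> f \<phi> u Du \<psi> D\<psi> x =
    conformal_weight f \<phi> (real CARD('m) / 2 - p) x *
      (\<Sum>j\<in>UNIV. sigma_frame p (\<lambda>j. Du x (axis j 1)) j \<bullet> D\<psi> x (axis j 1))
    - conformal_weight f \<phi> (real CARD('m) / 2) x *
      ((1 - (norm (u x))^2) * (1 / \<epsilon> ^ CARD('n)) * (u x \<bullet> \<psi> x))"
proof -
  define c where "c = 1 / sqrt (f x)"
  have c: "c > 0" using f by (simp add: c_def)
  have "c powr (2 * p - 1) * c = c powr (2 * p)"
    using c powr_add[of c "2 * p - 1" 1] by simp
  then have cc: "c powr (2 * p - 1) * c = f x powr (- p)"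
    using f by (simp add: c_def inverse_sqrt_powr)
  have "(\<Sum>j\<in>UNIV. sigma_frame p (frame_image f Du x) j \<bullet> frame_image f D\<psi> x j)
     = (\<Sum>j\<in>UNIV. (c powr (2 * p - 1) * c) * (sigma_frame p (\<lambda>j. Du x (axis j 1)) j \<bullet> D\<psi> x (axis j 1)))"
    unfolding frame_image_eq c_def[symmetric] sigma_frame_scaleR[OF c] by (simp add: mult_ac)
  also have "\<dots> = f x powr (- p) * (\<Sum>j\<in>UNIV. sigma_frame p (\<lambda>j. Du x (axis j 1)) j \<bullet> D\<psi> x (axis j 1))"
    unfolding cc by (simp add: sum_distrib_left)
  finally have S: "(\<Sum>j\<in>UNIV. sigma_frame p (frame_image f Du x) j \<bullet> frame_image f D\<psi> x j)
     = f x powr (- p) * (\<Sum>j\<in>UNIV. sigma_frame p (\<lambda>j. Du x (axis j 1)) j \<bullet> D\<psi> x (axis j 1))" .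
  have F: "f x powr (real CARD('m) / 2 - p) = f x powr (- p) * f x powr (real CARD('m) / 2)"
    by (simp add: powr_add[symmetric])
  have "(a * s - n / e * d) * b * t = b * (a * t) * s - b * t * (n * (1 / e) * d)" for a s n e d b t :: real
    by (simp add: algebra_simps)
  then show ?thesis
    unfolding weak_integrand_def conformal_weight_def S F .
qed

lemma has_derivative_conformal_weight:
  assumes \<phi>: "(\<phi> has_derivative D\<phi>) (at x within S)" and f: "(f has_derivative Df) (at x within S)"
    and pos: "f x > 0" and x: "x \<in> S"
  shows "(conformal_weight f \<phi> a has_derivative
    (\<lambda>v. conformal_weight f \<phi> a x * (a * Df v / f x - D\<phi> v))) (at x within S)"
proof -
  have "((\<lambda>x. f x powr a) has_derivative (\<lambda>v. f x powr a * (0 * ln (f x) + Df v * a / f x))) (at x within S)"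
    by (rule has_derivative_powr[OF f has_derivative_const pos x])
  moreover have "((\<lambda>x. exp (- \<phi> x)) has_derivative (\<lambda>v. - D\<phi> v * exp (- \<phi> x))) (at x within S)"
    by (auto intro!: derivative_eq_intros \<phi>)
  ultimately show ?thesis
    unfolding conformal_weight_def[abs_def]
    by (rule has_derivative_eq_rhs[OF has_derivative_mult[rotated]]) (auto simp: algebra_simps)
qed

text \<open>Unfolding the coinductive definition once gives a partial derivative along the axis that
  is itself smooth, hence continuous; uniqueness of derivatives identifies it with the value of the
  given total derivative.\<close>

lemma smooth_on_imp_continuous_partial:
  assumes "smooth_on U g" and g: "\<forall>x\<in>U. (g has_derivative Dg x) (at x)"
  shows "continuous_on U (\<lambda>x. Dg x (axis i 1))"
proof -
  obtain g' where g': "\<And>x. x \<in> U \<Longrightarrow> ((\<lambda>t. g (x + t *\<^sub>R axis i 1)) has_real_derivative g' x) (at 0)"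
    "smooth_on U g'"
    using assms(1) by (cases rule: smooth_on.cases) blast
  have eq: "g' x = Dg x (axis i 1)" if x: "x \<in> U" for x
  proof -
    have d: "(g has_derivative Dg x) (at (x + 0 *\<^sub>R axis i 1))" using g x by simp
    have "((\<lambda>t. x + t *\<^sub>R axis i 1) has_derivative (\<lambda>t. t *\<^sub>R axis i 1)) (at 0)"
      by (auto intro!: derivative_eq_intros)
    from has_derivative_compose[OF this d]
    have "((\<lambda>t. g (x + t *\<^sub>R axis i 1)) has_derivative (\<lambda>t. Dg x (t *\<^sub>R axis i 1))) (at 0)" .
    moreover have "(\<lambda>t. Dg x (t *\<^sub>R axis i 1)) = (*) (Dg x (axis i 1))"
      using linear_cmul[OF has_derivative_linear[OF d]] by (auto simp: mult.commute)
    ultimately have "((\<lambda>t. g (x + t *\<^sub>R axis i 1)) has_real_derivative Dg x (axis i 1)) (at 0)"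
      by (simp add: has_field_derivative_def)
    then show ?thesis using g'(1)[OF x] DERIV_unique by blast
  qed
  have "continuous_on U g'" using g'(2) by (cases rule: smooth_on.cases)
  then show ?thesis by (rule continuous_on_eq) (rule eq)
qed

text \<open>The whole line through x in direction j stays in the boundary, so \<open>u\<close> maps
  it to a curve in \<open>S\<close> defined for all times, as \<open>tangent_space\<close>
  demands.\<close>

lemma boundary_partial_in_tangent_space:
  assumes u: "(u has_derivative Du) (at x within half_space k)"
    and S: "u ` half_space_boundary k \<subseteq> S" and x: "x $ k = 0" and j: "j \<noteq> k"
  shows "Du (axis j 1) \<in> tangent_space S (u x)"
proof -
  define l :: "real \<Rightarrow> real^'a" where "l t = x + t *\<^sub>R axis j 1" for t
  have l: "l t $ k = 0" for t using x j by (simp add: l_def axis_def)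
  have ld: "(l has_derivative (\<lambda>t. t *\<^sub>R axis j 1)) (at 0)"
    unfolding l_def by (auto intro!: derivative_eq_intros)
  have "(u has_derivative Du) (at (l 0) within l ` UNIV)"
    using u by (auto simp: l_def[of 0] l intro: has_derivative_subset)
  from has_derivative_in_compose[OF ld this]
  have "((\<lambda>t. u (l t)) has_derivative (\<lambda>t. Du (t *\<^sub>R axis j 1))) (at 0)" .
  then have "((\<lambda>t. u (l t)) has_vector_derivative Du (axis j 1)) (at 0)"
    unfolding has_vector_derivative_def linear_cmul[OF has_derivative_linear[OF u]] .
  moreover have "u (l t) \<in> S" for t using S l by force
  ultimately show ?thesis
    unfolding tangent_space_def by (auto intro!: exI[of _ "\<lambda>t. u (l t)"] simp: l_def)
qed

text \<open>The gradient is known to vanish only in the open half space, which is convex; continuity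
  carries the constant value to the closure.\<close>

lemma constant_if_grad_zero:
  fixes u :: "real^'m::finite \<Rightarrow> real^'n"
  assumes u: "\<And>x. x \<in> half_space k \<Longrightarrow> (u has_derivative Du x) (at x within half_space k)"
    and 0: "\<And>x j. x $ k > 0 \<Longrightarrow> Du x (axis j 1) = 0"
  shows "\<exists>y. \<forall>x\<in>half_space k. u x = y"
proof -
  have "\<exists>y. \<forall>x\<in>half_space_interior k. u x = y"
  proof (rule has_derivative_zero_constant)
    show "convex (half_space_interior k)"
      using convex_halfspace_gt[of 0 "axis k 1 :: real^'m"] by (simp add: half_space_interior_def inner_axis')
    fix x assume x: "x \<in> half_space_interior k"
    then have "x \<in> half_space k" "at x within half_space k = at x"
      using at_within_half_space[of x k] by auto
    then have d: "(u has_derivative Du x) (at x)" using u by metis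
    have "Du x v = 0" for v
      by (subst linear_axis_expansion[OF has_derivative_linear[OF d]]) (use 0[of x] x in simp)
    then have "Du x = (\<lambda>_. 0)" by blast
    then show "(u has_derivative (\<lambda>h. 0)) (at x within half_space_interior k)"
      using d by (simp add: has_derivative_at_withinI)
  qed
  then obtain y where y: "\<And>x. x \<in> half_space_interior k \<Longrightarrow> u x = y" by blast
  have cl: "closure (half_space_interior k) = half_space k"
    unfolding half_space_interior_def half_space_def by simp
  have "continuous_on (half_space k) u" by (rule has_derivative_continuous_on[OF u])
  then have "u x = y" if "x \<in> half_space k" for x
    using continuous_constant_on_closure[of "half_space_interior k" u y x] y that unfolding cl by blast
  then show ?thesis by blast
qed

theorem theorem4p1:
  fixes k :: "'m::finite"
    and p \<epsilon> c :: real
    and S :: "(real^'n::finite) set"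
    and \<phi> f :: "real^'m \<Rightarrow> real"
    and D\<phi> Df :: "real^'m \<Rightarrow> real^'m \<Rightarrow> real"
    and u :: "real^'m \<Rightarrow> real^'n"
    and Du :: "real^'m \<Rightarrow> real^'m \<Rightarrow> real^'n"
    and U :: "(real^'m) set"
  assumes p_range: "2 \<le> p" "p < real CARD('m) - 2"
    and eps_pos: "\<epsilon> > 0"
    and S_sub: "submanifold S"
    and U_open: "open U" and U_nbhd: "half_space k \<subseteq> U"
    and phi_smooth: "smooth_on U \<phi>"
    and f_smooth: "smooth_on U f"
    and phi_deriv: "\<forall>x\<in>U. (\<phi> has_derivative D\<phi> x) (at x)"
    and f_deriv: "\<forall>x\<in>U. (f has_derivative Df x) (at x)"
    and f_pos: "\<forall>x\<in>half_space k. f x > 0"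
    and f_radial: "\<forall>x\<in>half_space k. Df x x \<ge> 0"
    and c_pos: "c > 0"
    and ineq: "\<forall>x\<in>half_space k.
                 (c + 2*p - real CARD('m) + D\<phi> x x) * f x
                   \<le> (real CARD('m) / 2 - p) * Df x x"
    and u_deriv: "\<forall>x\<in>half_space k. (u has_derivative Du x) (at x within half_space k)"
    and u_C1: "\<forall>i. continuous_on (half_space k) (\<lambda>x. Du x (axis i 1))"
    and harmonic: "phi_Phi_harmonic k p \<epsilon> f \<phi> u Du"
    and bdry_in_S: "u ` half_space_boundary k \<subseteq> S"
    and bdry_perp: "\<forall>x\<in>half_space_boundary k. \<forall>v\<in>tangent_space S (u x).
                      Du x (axis k 1) \<bullet> v = 0"
    and finite_energy: "energy_integrand p \<epsilon> f \<phi> u Du integrable_on half_space k"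
  shows "\<exists>y. \<forall>x\<in>half_space k. u x = y"
proof -
  let ?H = "half_space k" and ?m = "real CARD('m)"
  define \<kappa> where "\<kappa> = 1 / \<epsilon> ^ CARD('n)"
  define w where "w = conformal_weight f \<phi>"
  define Dw where "Dw a x v = w a x * (a * Df x v / f x - D\<phi> x v)" for a x v
  have f_der: "(f has_derivative Df x) (at x within ?H)" and \<phi>_der: "(\<phi> has_derivative D\<phi> x) (at x within ?H)"
    if "x \<in> ?H" for x
    using that U_nbhd f_deriv phi_deriv by (blast intro: has_derivative_at_withinI)+
  have "0 \<in> ?H" by simp
  \<comment> \<open>At the origin both radial derivatives are a linear map applied to the zero
    vector.\<close>
  have "(c + 2*p - ?m) * f 0 \<le> 0"
    using ineq[rule_format, OF \<open>0 \<in> ?H\<close>] linear_0[OF has_derivative_linear[OF f_der[OF \<open>0 \<in> ?H\<close>]]]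
      linear_0[OF has_derivative_linear[OF \<phi>_der[OF \<open>0 \<in> ?H\<close>]]] by simp
  then have "c + 2*p - ?m \<le> 0" using f_pos \<open>0 \<in> ?H\<close> by (simp add: mult_le_0_iff not_le[symmetric])
  then have pm: "2 * p < ?m" using c_pos by linarith
  have w_pos: "w a x > 0" if "x \<in> ?H" for a x
    using f_pos[rule_format, OF that] by (simp add: w_def conformal_weight_def)
  have w_der: "(w a has_derivative Dw a x) (at x within ?H)" if "x \<in> ?H" for a x
    using has_derivative_conformal_weight[OF \<phi>_der[OF that] f_der[OF that] _ that, of a] f_pos that
    unfolding w_def Dw_def[abs_def] by simp
  have w_C1: "continuous_on ?H (\<lambda>x. Dw a x (axis j 1))" for a j
  proof -
    have "continuous_on ?H (w a)" by (rule has_derivative_continuous_on[OF w_der])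
    moreover have "continuous_on ?H f" by (rule has_derivative_continuous_on[OF f_der])
    moreover have "continuous_on ?H (\<lambda>x. Df x (axis j 1))"
      by (rule continuous_on_subset[OF smooth_on_imp_continuous_partial[OF f_smooth f_deriv] U_nbhd])
    moreover have "continuous_on ?H (\<lambda>x. D\<phi> x (axis j 1))"
      by (rule continuous_on_subset[OF smooth_on_imp_continuous_partial[OF phi_smooth phi_deriv] U_nbhd])
    ultimately show ?thesis
      unfolding Dw_def using f_pos by (intro continuous_intros) fastforce+
  qed
  interpret weighted_weak_solution k p \<kappa> "w (?m/2 - p)" "w (?m/2)" "Dw (?m/2 - p)" "Dw (?m/2)" u Du
  proof
    show "2 \<le> p" by (rule p_range)
    show "2 * p < ?m" by (rule pm)
    show "\<kappa> \<ge> 0" using eps_pos by (simp add: \<kappa>_def)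
    show "w (?m/2 - p) x \<ge> 0" "w (?m/2) x \<ge> 0" if "x \<in> ?H" for x
      using w_pos[OF that] by (auto intro: less_imp_le)
    show "(w (?m/2 - p) has_derivative Dw (?m/2 - p) x) (at x within ?H)"
      "(w (?m/2) has_derivative Dw (?m/2) x) (at x within ?H)" if "x \<in> ?H" for x
      by (rule w_der[OF that])+
    show "continuous_on ?H (\<lambda>x. Dw (?m/2 - p) x (axis j 1))" "continuous_on ?H (\<lambda>x. Dw (?m/2) x (axis j 1))" for j
      by (rule w_C1)+
    show "(u has_derivative Du x) (at x within ?H)" if "x \<in> ?H" for x using u_deriv that by blast
    show "continuous_on ?H (\<lambda>x. Du x (axis j 1))" for j using u_C1 by blast
    show "(\<lambda>x. w (?m/2 - p) x * frame_density p (\<lambda>j. Du x (axis j 1)) + w (?m/2) x * potential \<kappa> (u x)) integrable_on ?H"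
      unfolding w_def \<kappa>_def
      by (rule integrable_eq[OF finite_energy]) (rule energy_integrand_conformal, use f_pos in blast)
    fix \<psi> :: "real^'m \<Rightarrow> real^'n" and D\<psi>
    assume "\<And>x. (\<psi> has_derivative D\<psi> x) (at x)" "\<And>j. continuous_on UNIV (\<lambda>x. D\<psi> x (axis j 1))"
      "compact (closure {x. \<psi> x \<noteq> 0})" "closure {x. \<psi> x \<noteq> 0} \<subseteq> half_space_interior k"
    then have "(weak_integrand p \<epsilon> f \<phi> u Du \<psi> D\<psi> has_integral 0) ?H"
      using harmonic unfolding phi_Phi_harmonic_def by blast
    then show "((\<lambda>x. w (?m/2 - p) x * (\<Sum>j\<in>UNIV. sigma_frame p (\<lambda>j. Du x (axis j 1)) j \<bullet> D\<psi> x (axis j 1))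
             - w (?m/2) x * ((1 - (norm (u x))^2) * \<kappa> * (u x \<bullet> \<psi> x))) has_integral 0) ?H"
      unfolding w_def \<kappa>_def
      by (rule has_integral_cong[THEN iffD1, rotated]) (rule weak_integrand_conformal, use f_pos in blast)
  qed
  have energy_0: "energy x = 0" if "x $ k > 0" for x
  proof (rule energy_vanishes[OF c_pos _ _ _ that])
    fix x assume x: "x \<in> ?H"
    have fx: "f x > 0" "Df x x \<ge> 0" using f_pos f_radial x by auto
    have "(c + 2*p - ?m + D\<phi> x x) \<le> (?m/2 - p) * Df x x / f x"
      using ineq x fx by (simp add: pos_le_divide_eq)
    then have 1: "c \<le> ((?m/2 - p) * Df x x / f x - D\<phi> x x) + (?m - 2*p)" by linarith
    \<comment> \<open>The logarithmic radial derivatives of the two weights differ by this quantity,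
      whose sign comes from the radial monotonicity of f. Together with m - 2p \<le> m it transfers
      the bound from the gradient part to the potential.\<close>
    have "0 \<le> p * (Df x x / f x)" using fx p_range by simp
    then have 2: "c \<le> (?m/2 * Df x x / f x - D\<phi> x x) + ?m"
      using 1 p_range by (simp add: left_diff_distrib diff_divide_distrib)
    show "c * w (?m/2 - p) x \<le> Dw (?m/2 - p) x x + (?m - 2*p) * w (?m/2 - p) x"
      using mult_left_mono[OF 1 less_imp_le[OF w_pos[OF x]], of "?m/2 - p"]
      unfolding Dw_def by (simp add: algebra_simps)
    show "c * w (?m/2) x \<le> Dw (?m/2) x x + ?m * w (?m/2) x"
      using mult_left_mono[OF 2 less_imp_le[OF w_pos[OF x]], of "?m/2"]
      unfolding Dw_def by (simp add: algebra_simps)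
  next
    fix x :: "real^'m" and j assume "x $ k = 0" "j \<noteq> k"
    \<comment> \<open>Tangential derivatives are tangent to \<open>S\<close>, and the free boundary
      condition makes the normal derivative perpendicular to them.\<close>
    then show "grad x k \<bullet> grad x j = 0"
      using boundary_partial_in_tangent_space[OF _ bdry_in_S, of "Du x" x j] u_deriv bdry_perp
      unfolding grad_def by simp
  qed
  have Du_0: "Du x (axis j 1) = 0" if "x $ k > 0" for x j
  proof -
    have x: "x \<in> ?H" using that by simp
    \<comment> \<open>The energy is a sum of nonnegative terms, so the gradient part vanishes by
      itself, and its weight is positive.\<close>
    have "0 \<le> w (?m/2) x * potential \<kappa> (u x)"
      by (intro mult_nonneg_nonneg potential_nonneg kappa w0_nonneg[OF x])
    then have "w (?m/2 - p) x * frame_density p (grad x) \<le> 0"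
      using energy_0[OF that] unfolding energy_def by linarith
    then have "frame_density p (grad x) = 0"
      using w_pos[OF x, of "?m/2 - p"] density_nonneg[of x] by (auto simp: mult_le_0_iff)
    then show ?thesis
      using frame_density_eq_0D[OF p2 pm, of "grad x" j] by (simp add: grad_def)
  qed
  show ?thesis by (rule constant_if_grad_zero[OF u_deriv Du_0])
qed

end
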